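(* Let $F(z,u)=-\log\big(1-uH(z)\big)$ be a critical cycle composition scheme, i.e. $H(\rho_H)=1$, where $H$ has a singular exponent $0<\lambda_H<1$ (assumptions on $H$ as in the context). Let $X_n$ be the core size, $\mathbb P\{X_n=k\}=\frac{[z^nu^k]F(z,u)}{[z^n]F(z,1)}$. Then for every integer $s\ge1$ the factorial moments satisfy, as $n\to\infty$, $$\mathbb E\big(X_n(X_n-1)\cdots(X_n-s+1)\big)\sim\kappa^s\,n^{s\lambda_H}\,\mu_s,\qquad \kappa=\frac1{-c_H},\qquad \mu_s=\frac{\Gamma(s+1)}{\Gamma(s\lambda_H+1)}.$$ The scaled random variable $X_n/(\kappa n^{\lambda_H})$ converges in distribution, with convergence of all moments, to a random variable with the Mittag-Leffler distribution $\mathrm{ML}(\lambda_H)$.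
   Context: $H(z)=\sum_nh_nz^n$ is a power series with nonnegative coefficients, $H(0)=0$, finite radius of convergence $\rho_H>0$, whose only singularity on $|z|\le\rho_H$ is $z=\rho_H$; it is analytic in a domain $\{|z|<\rho_H+\varepsilon,\ |\arg(z-\rho_H)|>\theta\}$ for some $\varepsilon>0$, $0<\theta<\pi/2$, and there, as $z\to\rho_H$, $H(z)=H(\rho_H)+c_H(1-z/\rho_H)^{\lambda_H}(1+o(1))$ with $c_H\ne0$ (then $c_H<0$). $\mathrm{ML}(\alpha)$, $0<\alpha<1$, is the law of $S_\alpha^{-\alpha}$, where $S_\alpha>0$ has Laplace transform $\mathbb E(e^{-tS_\alpha})=e^{-t^\alpha}$; equivalently, the law determined by the moments $\Gamma(s+1)/\Gamma(\alpha s+1)$. *)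

theory Defs
  imports "HOL-Probability.Probability" "HOL-Complex_Analysis.Complex_Analysis"
    "HOL-Real_Asymp.Real_Asymp"
begin

(* The bivariate series F(z,u) = -log(1 - u H(z)) as a formal power series in z (outer)
   whose coefficients are formal power series in u (inner); fps_const fps_X is the variable u.
   The series -log(1 - w) = (\<Sum>k\<ge>1. w^k / k) is spelled out because fps_ln requires a coefficient
   field.  The composition is meaningful for H(0) = 0. *)
definition cycle_gf :: "(nat \<Rightarrow> real) \<Rightarrow> real fps fps" where
  "cycle_gf h =
     fps_compose (Abs_fps (\<lambda>k. if k = 0 then 0 else fps_const (1 / real k)))
       (fps_const fps_X * Abs_fps (\<lambda>n. fps_const (h n)))"

(* The univariate series F(z,1) = -log(1 - H(z)); fps_ln 1 is the series of log(1 + w). *)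
definition cycle_gf_at_1 :: "(nat \<Rightarrow> real) \<Rightarrow> real fps" where
  "cycle_gf_at_1 h = - fps_compose (fps_ln 1) (- Abs_fps h)"

lemma fps_const_coeffs_power:
  "(Abs_fps (\<lambda>n. fps_const (h n)) ^ k) $ n = fps_const ((Abs_fps h ^ k) $ n)"
  for h :: "nat \<Rightarrow> real"
proof (induction k arbitrary: n)
  case 0
  show ?case by simp
next
  case (Suc k)
  have sum_const: "(\<Sum>i\<in>A. fps_const (f i)) = fps_const (sum f A)" if "finite A"
    for A :: "nat set" and f :: "nat \<Rightarrow> real"
    using that by (induction rule: finite_induct) auto
  show ?case
    by (simp add: fps_mult_nth Suc.IH sum_const)
qed

lemma cycle_gf_nth:
  assumes "h 0 = 0"
  shows "cycle_gf h $ n $ k = (if k = 0 then 0 else (Abs_fps h ^ k) $ n / real k)"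
proof -
  have zero: "(Abs_fps h ^ k) $ n = 0" if "n < k"
    using startsby_zero_power_prefix[of "Abs_fps h" k] that assms by auto
  have "cycle_gf h $ n $ k =
     (\<Sum>i=0..n. (if i = 0 then 0 else fps_const ((Abs_fps h ^ i) $ n / real i) * fps_X ^ i)) $ k"
    unfolding cycle_gf_def fps_compose_nth power_mult_distrib fps_const_power
    by (intro arg_cong[where f = "\<lambda>f. f $ k"] sum.cong refl)
       (simp add: fps_const_coeffs_power mult.commute mult.left_commute)
  also have "\<dots> = (\<Sum>i=0..n. if i = k then (if k = 0 then 0 else (Abs_fps h ^ k) $ n / real k) else 0)"
    unfolding fps_sum_nth by (intro sum.cong refl) auto
  also have "\<dots> = (if k = 0 then 0 else (Abs_fps h ^ k) $ n / real k)"
    using zero by auto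
  finally show ?thesis .
qed

lemma cycle_gf_at_1_nth:
  assumes "h 0 = 0"
  shows "cycle_gf_at_1 h $ n = (\<Sum>k\<le>n. cycle_gf h $ n $ k)"
proof -
  have neg: "(- Abs_fps h) ^ i = fps_const ((- 1) ^ i) * Abs_fps h ^ i" for i
    by (subst power_minus) (metis fps_const_1_eq_1 fps_const_neg fps_const_power)
  have sgn: "(- 1) ^ (i - Suc 0) * ((- 1) ^ i * x) = - x" if "i > 0" for i and x :: real
    using that by (cases i) (auto simp: mult.assoc[symmetric] power_add[symmetric])
  have "cycle_gf_at_1 h $ n = - (\<Sum>i=0..n. fps_ln 1 $ i * ((- 1) ^ i * (Abs_fps h ^ i) $ n))"
    unfolding cycle_gf_at_1_def by (simp add: fps_compose_nth neg)
  also have "\<dots> = (\<Sum>i=0..n. if i = 0 then 0 else (Abs_fps h ^ i) $ n / real i)"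
    unfolding sum_negf[symmetric]
    by (intro sum.cong refl) (auto simp: fps_ln_def sgn simp flip: minus_divide_left)
  finally show ?thesis
    by (simp add: cycle_gf_nth[where h = h, OF assms] atMost_atLeast0)
qed

(* An indented (Delta-)domain at \<rho>.  It does not contain \<rho> (Arg 0 = 0), but for \<theta> < pi/2 it
   contains every other point of the closed disc |z| \<le> \<rho>, so analyticity there says in
   particular that \<rho> is the only singularity on that disc. *)
definition delta_domain :: "real \<Rightarrow> real \<Rightarrow> real \<Rightarrow> complex set" where
  "delta_domain \<rho> \<epsilon> \<theta> = {z. norm z < \<rho> + \<epsilon> \<and> \<bar>Arg (z - of_real \<rho>)\<bar> > \<theta>}"

(* The law of the positive stable variable S_\<alpha>, with Laplace transform exp(-t^\<alpha>). *)
definition positive_stable_law :: "real \<Rightarrow> real measure \<Rightarrow> bool" where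
  "positive_stable_law \<alpha> S \<longleftrightarrow>
     real_distribution S \<and> (AE x in S. 0 < x) \<and>
     (\<forall>t\<ge>0. (\<integral>x. exp (- (t * x)) \<partial>S) = exp (- (t powr \<alpha>)))"

definition mittag_leffler_law :: "real \<Rightarrow> real measure \<Rightarrow> bool" where
  "mittag_leffler_law \<alpha> L \<longleftrightarrow>
     (\<exists>S. positive_stable_law \<alpha> S \<and> L = distr S borel (\<lambda>x. x powr (- \<alpha>)))"

end

(* With the core variable marked by u, the s-th factorial moment of X_n is
     (s-1)! [z^n] (H/(1-H))^s / [z^n] log (1/(1-H)),
   and both coefficients follow from a transfer theorem, since 1 - H(z) ~ (1 - z/rho)^lam / kappa.
   The o-transfer needs no Hankel contour: in the unit disc the discs of radius proportional to
   |1 - z| stay inside the Delta-domain, so Cauchy's estimate turns f = o(|1-z|^(-a)) into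
   f'' = o(|1-z|^(-a-2)), and integrating f'' over the circle |z| = 1 - 1/n suffices because the
   mean of |1-z|^(-2) is a Poisson kernel mean.
   A positive stable law is a weak limit of normalised sums of Sibuya variables, whose generating
   function is 1 - (1-z)^alpha.  The moments of its (-alpha)-th power follow by integrating the
   Laplace transform against t^(alpha s - 1), and they grow slowly enough for the method of moments. *)
theory Submission
  imports Defs
begin

section \<open>Transfer of little-o estimates to coefficients\<close>

text \<open>The hypotheses do not say that \<open>H\<close> takes the value 1 on the circle only at
  the singularity, so zeros of \<open>1 - H\<close> elsewhere on it have to be excluded. Nonnegative
  coefficients force such a point to be a root of unity under which \<open>H\<close> is invariant,
  and this would copy the singular behaviour with exponent \<open>lam < 1\<close> to a point where
  \<open>H\<close> is analytic. Outside the closed disc zeros of \<open>1 - H\<close> may well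
  exist; therefore the transfer theorem asks for analyticity only on the closed disc and near the
  singularity, not on a whole Delta-domain. The numerator of the moment comes from k (k-1) ...
  (k-s+1) / k = (s-1)! (k-1 choose s-1), the coefficient of w^k in (s-1)! (w / (1-w))^s. The
  conclusion asserts that a limit law exists, and a Mittag-Leffler law is by definition the image of
  a stable law. So a stable law has to be constructed; the moments alone do not provide one.\<close>

lemma poisson_kernel_mean:
  fixes R :: real
  assumes R: "0 < R" "R < 1"
  shows "((\<lambda>t. 1 / (norm (1 - of_real R * exp (2 * of_real pi * \<i> * of_real t)))\<^sup>2)
           has_integral 1 / (1 - R\<^sup>2)) {0..1}"
proof -
  define e where "e t = exp (2 * complex_of_real pi * \<i> * of_real t)" for t :: real
  have e1: "norm (e t) = 1" for t by (simp add: e_def norm_exp_eq_Re)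
  have vd: "vector_derivative (\<lambda>x. R * exp (2 * complex_of_real pi * \<i> * of_real x)) (at t within {0..1})
      = 2 * pi * \<i> * R * e t" if "t \<in> {0..1}" for t
    using vector_derivative_circlepath01[of t 0 R] that by (simp add: circlepath e_def)
  have R2: "R\<^sup>2 < R" using R by (simp add: power2_eq_square)
  have ne: "u \<noteq> 1" if "norm u \<le> R" for u :: complex using that R by auto
  \<comment> \<open>On |u| = R the conjugate of u is R^2 / u, so |1 - u|^2 = (1 - u) (u - R^2) / u.
    The mean is thus Cauchy's formula for 1 / (1 - u) at the point R^2 inside the circle.\<close>
  have "((\<lambda>u. (1 / (1 - u)) / (u - of_real (R\<^sup>2))) has_contour_integral
          (2 * of_real pi * \<i> * (1 / (1 - of_real (R\<^sup>2))))) (circlepath 0 R)"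
    by (rule Cauchy_integral_circlepath) (use R R2 ne in \<open>auto intro!: continuous_intros holomorphic_intros simp: norm_power\<close>)
  then have "((\<lambda>t. (1 / (1 - R * e t)) / (R * e t - of_real (R\<^sup>2)) * (2 * pi * \<i> * R * e t)) has_integral
          (2 * of_real pi * \<i> * (1 / (1 - of_real (R\<^sup>2))))) {0..1}"
    unfolding has_contour_integral_def
    by (rule has_integral_eq[rotated])
       (use R in \<open>auto simp: vd circlepath\<close>, simp_all add: e_def)
  then have "((\<lambda>t. 1 / (2 * pi * \<i>) * ((1 / (1 - R * e t)) / (R * e t - of_real (R\<^sup>2)) * (2 * pi * \<i> * R * e t))) has_integral
          1 / (2 * pi * \<i>) * (2 * of_real pi * \<i> * (1 / (1 - of_real (R\<^sup>2))))) {0..1}"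
    by (rule has_integral_mult_right)
  then have *: "((\<lambda>t. complex_of_real (1 / (norm (1 - of_real R * e t))\<^sup>2)) has_integral
          of_real (1 / (1 - R\<^sup>2))) {0..1}"
  proof (rule has_integral_eq_rhs[OF has_integral_eq[rotated]])
    fix t
    have n1: "1 - R * e t \<noteq> 0" using ne[of "R * e t"] R by (simp add: norm_mult e1)
    have ee: "e t * cnj (e t) = 1" using e1[of t] by (simp add: complex_norm_square[symmetric])
    have eq: "R * e t - of_real (R\<^sup>2) = R * e t * cnj (1 - R * e t)"
      using ee by (simp add: algebra_simps power2_eq_square)
    have n0: "e t \<noteq> 0" by (simp add: e_def)
    have cancel: "1 / (2 * pi * \<i>) * (1 / a / (x * b) * (2 * pi * \<i> * x)) = 1 / (a * b)"
      if "x \<noteq> 0" for a b x using that by simp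
    have "1 / (2 * pi * \<i>) * ((1 / (1 - R * e t)) / (R * e t - of_real (R\<^sup>2)) * (2 * pi * \<i> * R * e t))
        = 1 / ((1 - R * e t) * cnj (1 - R * e t))"
      unfolding eq using cancel[of "R * e t"] n0 R by (simp add: mult.assoc)
    also have "\<dots> = complex_of_real (1 / (norm (1 - of_real R * e t))\<^sup>2)"
      by (simp only: complex_norm_square of_real_divide of_real_1)
    finally show "1 / (2 * pi * \<i>) * ((1 / (1 - R * e t)) / (R * e t - of_real (R\<^sup>2)) * (2 * pi * \<i> * R * e t))
      = complex_of_real (1 / (norm (1 - of_real R * e t))\<^sup>2)" .
  qed simp
  from has_integral_linear[OF this bounded_linear_Re] show ?thesis
    by (simp add: o_def e_def)
qed

text \<open>The bound is averaged over the circle instead of being replaced by its maximum: for K >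
  0, K / |1 - z|^2 has maximum K / (1 - R)^2 there but mean only K / (1 - R^2), which saves a factor
  of order n for R = 1 - 1/n.\<close>

lemma higher_deriv_bound_poisson:
  fixes R :: real
  assumes R: "0 < R" "R < 1"
    and g: "g holomorphic_on ball 0 1"
    and bound: "\<And>z. norm z = R \<Longrightarrow> norm (g z) \<le> B + K / (norm (1 - z))\<^sup>2"
  shows "norm ((deriv ^^ n) g 0 / fact n) \<le> (B + K / (1 - R\<^sup>2)) / R ^ n"
proof -
  define e where "e t = exp (2 * complex_of_real pi * \<i> * of_real t)" for t :: real
  have e1: "norm (e t) = 1" for t by (simp add: e_def norm_exp_eq_Re)
  have vd: "vector_derivative (\<lambda>x. R * exp (2 * complex_of_real pi * \<i> * of_real x)) (at t within {0..1})
      = 2 * pi * \<i> * R * e t" if "t \<in> {0..1}" for t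
    using vector_derivative_circlepath01[of t 0 R] that by (simp add: circlepath e_def)
  have "((\<lambda>u. g u / (u - 0) ^ Suc n) has_contour_integral
          (2 * pi * \<i> / fact n * (deriv ^^ n) g 0)) (circlepath 0 R)"
    by (rule Cauchy_has_contour_integral_higher_derivative_circlepath)
       (use R in \<open>auto intro!: holomorphic_on_imp_continuous_on holomorphic_on_subset[OF g]\<close>)
  then have 1: "((\<lambda>t. g (R * e t) / (R * e t) ^ Suc n * (2 * pi * \<i> * R * e t)) has_integral
          (2 * pi * \<i> / fact n * (deriv ^^ n) g 0)) {0..1}"
    unfolding has_contour_integral_def
    by (rule has_integral_eq[rotated])
       (use R in \<open>auto simp: vd circlepath\<close>, simp_all add: e_def)
  have 2: "((\<lambda>t. (2 * pi / R ^ n) * (B + K * (1 / (norm (1 - R * e t))\<^sup>2))) has_integral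
     (2 * pi / R ^ n) * (B + K * (1 / (1 - R\<^sup>2)))) {0..1}"
    unfolding e_def
    by (intro has_integral_mult_right has_integral_add poisson_kernel_mean R)
       (use has_integral_const_real[of B 0 1] in simp)
  have "norm (2 * pi * \<i> / fact n * (deriv ^^ n) g 0) \<le> (2 * pi / R ^ n) * (B + K * (1 / (1 - R\<^sup>2)))"
    unfolding integral_unique[OF 1, symmetric] integral_unique[OF 2, symmetric]
  proof (rule Henstock_Kurzweil_Integration.integral_norm_bound_integral)
    fix t
    have n0: "e t \<noteq> 0" by (simp add: e_def)
    have "norm (g (R * e t) / (R * e t) ^ Suc n * (2 * pi * \<i> * R * e t)) =
      (2 * pi / R ^ n) * norm (g (R * e t))"
      using R n0 by (simp add: norm_mult norm_divide norm_power e1)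
    also have "\<dots> \<le> (2 * pi / R ^ n) * (B + K * (1 / (norm (1 - R * e t))\<^sup>2))"
      using bound[of "R * e t"] R by (intro mult_left_mono) (auto simp: norm_mult e1)
    finally show "norm (g (R * e t) / (R * e t) ^ Suc n * (2 * pi * \<i> * R * e t)) \<le> \<dots>" .
  qed (use 1 2 in \<open>auto simp: integrable_on_def\<close>)
  then have "2 * pi * norm ((deriv ^^ n) g 0 / fact n) \<le> 2 * pi * ((B + K / (1 - R\<^sup>2)) / R ^ n)"
    by (simp add: norm_mult norm_divide)
  then show ?thesis by (subst (asm) mult_le_cancel_left_pos) auto
qed

text \<open>Cosine decreases on [0, pi], so the condition on \<open>Arg\<close> becomes an
  inequality between a real part and a norm. Both change by at most the distance when a point is
  moved, unlike \<open>Arg\<close>, which jumps at its cut.\<close>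

lemma in_delta_domain_iff:
  assumes "0 < \<theta>" "\<theta> < pi / 2" "w \<noteq> of_real \<rho>"
  shows "w \<in> delta_domain \<rho> \<epsilon> \<theta> \<longleftrightarrow>
           norm w < \<rho> + \<epsilon> \<and> Re (w - of_real \<rho>) < norm (w - of_real \<rho>) * cos \<theta>"
proof -
  define u where "u = w - of_real \<rho>"
  have u: "norm u > 0" using assms by (simp add: u_def)
  have "Re u = norm u * cos (Arg u)"
    by (metis rcis_cmod_Arg Re_rcis)
  also have "cos (Arg u) = cos \<bar>Arg u\<bar>" by (simp add: abs_if)
  finally have "Re u < norm u * cos \<theta> \<longleftrightarrow> cos \<bar>Arg u\<bar> < cos \<theta>" using u by simp
  also have "\<dots> \<longleftrightarrow> \<theta> < \<bar>Arg u\<bar>"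
    using assms Arg_bounded[of u] by (intro cos_mono_less_eq) (auto simp: abs_le_iff abs_if)
  finally show ?thesis unfolding delta_domain_def u_def by simp
qed

lemma delta_domain_contains_cball:
  assumes th: "0 < \<theta>" "\<theta> < pi / 2" and "0 < \<epsilon>" and z: "norm z \<le> 1" "z \<noteq> 1"
  shows "z \<in> delta_domain 1 \<epsilon> \<theta>"
proof -
  have "Re z < 1"
proof (rule ccontr)
    assume "\<not> Re z < 1"
    then have 1: "(Re z)\<^sup>2 \<ge> 1" using one_le_power[of "Re z" 2] by simp
    moreover have "(Re z)\<^sup>2 + (Im z)\<^sup>2 \<le> 1"
      using z by (simp add: cmod_power2[symmetric] power_le_one)
    ultimately have "(Im z)\<^sup>2 \<le> 0" "(Re z)\<^sup>2 = 1" using zero_le_power2[of "Im z"] by linarith+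
    then show False using z \<open>\<not> Re z < 1\<close> by (auto simp: power2_eq_1_iff complex_eq_iff)
  qed
  moreover have "cos \<theta> > 0" using th by (intro cos_gt_zero) auto
  ultimately show ?thesis
    using z assms in_delta_domain_iff[of \<theta> z 1 \<epsilon>] by (smt (verit) Re_complex_of_real mult_nonneg_nonneg norm_ge_zero minus_complex.sel(1) of_real_1 one_complex.sel(1))
qed

text \<open>In the unit disc Re (z - 1) is negative. A point w with |w - z| \<le> \<delta> |z - 1|
  thus has Re (w - 1) < \<delta> |z - 1|, while |w - 1| stays comparable with |z - 1|; this keeps w
  off the excluded cone.\<close>

lemma delta_domain_contains_disc:
  assumes th: "0 < \<theta>" "\<theta> < pi / 2" and "0 < \<epsilon>"
  obtains \<delta> where "0 < \<delta>" "\<delta> \<le> 1 / 2"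
    "\<And>z w. norm z < 1 \<Longrightarrow> norm (w - z) \<le> \<delta> * norm (z - 1) \<Longrightarrow> w \<in> delta_domain 1 \<epsilon> \<theta>"
proof
  \<comment> \<open>With y = |z - 1| < 2, the entry 1/2 gives |w - 1| \<ge> y / 2, the entry
    \<epsilon> / 2 gives |w| < 1 + \<epsilon>, and the entry cos \<theta> / 2 gives Re (w - 1) < |w
    - 1| cos \<theta>.\<close>
  define \<delta> where "\<delta> = Min {1 / 2, \<epsilon> / 2, cos \<theta> / 2}"
  have c: "cos \<theta> > 0" using th by (intro cos_gt_zero) auto
  show d: "0 < \<delta>" "\<delta> \<le> 1 / 2" using c assms by (auto simp: \<delta>_def)
  have d2: "\<delta> \<le> \<epsilon> / 2" "\<delta> \<le> cos \<theta> / 2" by (auto simp: \<delta>_def)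
  fix z w :: complex assume z: "norm z < 1" and w: "norm (w - z) \<le> \<delta> * norm (z - 1)"
  define y where "y = norm (z - 1)"
  have y: "y > 0" "y < 2" using z norm_triangle_ineq4[of z 1] by (auto simp: y_def)
  have dy: "\<delta> * y \<le> (1 / 2) * y" using d y by (intro mult_right_mono) auto
  have "norm w \<le> norm z + norm (w - z)" by (metis norm_triangle_sub)
  moreover have "\<delta> * y \<le> (\<epsilon> / 2) * y" "(\<epsilon> / 2) * y \<le> (\<epsilon> / 2) * 2" using d2 y assms by (auto intro!: mult_mono)
  ultimately have 1: "norm w < 1 + \<epsilon>" using z w by (simp add: y_def)
  have "norm (z - 1) \<le> norm (w - 1) + norm (w - z)"
    by (metis (no_types, lifting) norm_minus_commute norm_triangle_ineq add_diff_eq diff_add_cancel add.commute)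
  with w dy have 2: "norm (w - 1) \<ge> y / 2" unfolding y_def by linarith
  have "Re (w - 1) = Re (z - 1) + Re (w - z)" by simp
  also have "\<dots> < \<delta> * y" using w z complex_Re_le_cmod[of "w - z"] complex_Re_le_cmod[of z] by (simp add: y_def)
  also have "\<dots> \<le> (cos \<theta> / 2) * y" using d2 y by (intro mult_right_mono) auto
  also have "\<dots> \<le> norm (w - 1) * cos \<theta>" using mult_right_mono[OF 2, of "cos \<theta>"] c by simp
  finally have 3: "Re (w - 1) < norm (w - 1) * cos \<theta>" .
  have "w \<noteq> 1" using 2 y by auto
  with 1 3 show "w \<in> delta_domain 1 \<epsilon> \<theta>" using in_delta_domain_iff[of \<theta> w 1 \<epsilon>] th by simp
qed

text \<open>Near 1, Cauchy's estimate on a disc of radius proportional to |z - 1| costs a factor |z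
  - 1|^(-2). Away from 1 the second derivative is bounded by compactness. A smaller \<eta> shrinks
  the neighbourhood of 1 and is paid for by a larger \<open>B\<close>.\<close>

lemma deriv_2_bound_of_little_o:
  fixes f :: "complex \<Rightarrow> complex" and a :: real
  assumes th: "0 < \<theta>" "\<theta> < pi / 2" and eps: "0 < \<epsilon>" and a: "0 \<le> a"
    and an: "f analytic_on cball 0 1 - {1}"
    and near: "\<forall>\<^sub>F z in at 1 within delta_domain 1 \<epsilon> \<theta>. f analytic_on {z}"
    and lim: "((\<lambda>z. f z * (1 - z) powr of_real a) \<longlongrightarrow> 0) (at 1 within delta_domain 1 \<epsilon> \<theta>)"
    and eta: "0 < \<eta>"
  obtains B where "0 \<le> B"
    "\<And>z. norm z < 1 \<Longrightarrow> norm ((deriv ^^ 2) f z) \<le> B + \<eta> * norm (1 - z) powr (- a - 2)"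
proof -
  obtain \<delta> where d: "0 < \<delta>" "\<delta> \<le> 1 / 2" and disc:
    "\<And>z w. norm z < 1 \<Longrightarrow> norm (w - z) \<le> \<delta> * norm (z - 1) \<Longrightarrow> w \<in> delta_domain 1 \<epsilon> \<theta>"
    using delta_domain_contains_disc[OF th eps] by blast
  \<comment> \<open>Chosen so that Cauchy's bound 2! \<eta>' (y/2)^(-a) / (\<delta> y)^2 equals
    \<eta> y^(-a-2) exactly.\<close>
  define \<eta>' where "\<eta>' = \<eta> * \<delta>\<^sup>2 / (2 * 2 powr a)"
  have eta': "\<eta>' > 0" using d eta by (simp add: \<eta>'_def)
  from lim eta' have "\<forall>\<^sub>F z in at 1 within delta_domain 1 \<epsilon> \<theta>. norm (f z * (1 - z) powr of_real a) < \<eta>'"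
    by (auto dest: tendstoD[where e = \<eta>'] simp: dist_norm)
  with near have "\<forall>\<^sub>F z in at 1 within delta_domain 1 \<epsilon> \<theta>.
      f analytic_on {z} \<and> norm (f z * (1 - z) powr of_real a) < \<eta>'"
    by (rule eventually_conj)
  then obtain r where r: "r > 0" and nr: "\<And>w. w \<in> delta_domain 1 \<epsilon> \<theta> \<Longrightarrow> w \<noteq> 1 \<Longrightarrow> norm (w - 1) < r \<Longrightarrow>
      f analytic_on {w} \<and> norm (f w * (1 - w) powr of_real a) < \<eta>'"
    by (auto simp: eventually_at dist_norm)
  have near_bound: "norm ((deriv ^^ 2) f z) \<le> \<eta> * norm (1 - z) powr (- a - 2)"
    if z: "norm z < 1" and zr: "norm (z - 1) < r / 2" for z
  proof -
    define y where "y = norm (z - 1)"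
    have y: "y > 0" using z by (auto simp: y_def)
    have dy: "\<delta> * y \<le> (1 / 2) * y" using d y by (intro mult_right_mono) auto
    have w: "f analytic_on {w}" "norm (f w) < \<eta>' * (y / 2) powr (- a)" if "norm (w - z) \<le> \<delta> * y" for w
    proof -
      have "norm (z - 1) \<le> norm (w - 1) + norm (w - z)"
        by (metis (no_types, lifting) norm_minus_commute norm_triangle_ineq add_diff_eq diff_add_cancel add.commute)
      with that dy have 2: "norm (w - 1) \<ge> y / 2" unfolding y_def by linarith
      have "norm (w - 1) \<le> norm (w - z) + norm (z - 1)"
        by (metis norm_triangle_ineq diff_add_cancel add_diff_eq)
      then have 3: "norm (w - 1) < r" using that dy zr y unfolding y_def by linarith
      have w1: "w \<noteq> 1" using 2 y by auto
      have n: "f analytic_on {w}" "norm (f w * (1 - w) powr of_real a) < \<eta>'"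
        using nr[of w] disc[OF z, of w] that w1 3 by (auto simp: y_def)
      then show "f analytic_on {w}" by simp
      have "norm (f w) * norm (w - 1) powr a < \<eta>'"
        using n by (simp add: norm_mult norm_powr_real_powr' norm_minus_commute)
      then have "norm (f w) < \<eta>' * norm (w - 1) powr (- a)"
        using w1 by (simp add: powr_minus field_simps)
      also have "\<dots> \<le> \<eta>' * (y / 2) powr (- a)"
        using 2 y a eta' by (intro mult_left_mono powr_mono2') auto
      finally show "norm (f w) < \<dots>" .
    qed
    have "f analytic_on cball z (\<delta> * y)"
      by (subst analytic_on_analytic_at) (auto intro!: w(1) simp: dist_norm norm_minus_commute)
    then have hol: "f holomorphic_on cball z (\<delta> * y)" by (rule analytic_imp_holomorphic)
    have "norm ((deriv ^^ 2) f z) \<le> fact 2 * (\<eta>' * (y / 2) powr (- a)) / (\<delta> * y) ^ 2"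
      by (rule Cauchy_higher_deriv_bound[where y = 0])
         (use y d in \<open>auto intro!: w(2) holomorphic_on_imp_continuous_on hol holomorphic_on_subset[OF hol]
            simp: dist_norm norm_minus_commute\<close>)
    also have "\<dots> = \<eta> * y powr (- a - 2)"
    proof -
      have "y powr (- a - 2) = y powr (- a) / y\<^sup>2" using y by (simp add: powr_diff)
      moreover have "(y / 2) powr (- a) = y powr (- a) * 2 powr a" using y by (simp add: powr_divide powr_minus field_simps)
      ultimately show ?thesis using y d by (simp add: \<eta>'_def power_mult_distrib field_simps)
    qed
    finally show ?thesis by (simp add: y_def norm_minus_commute)
  qed
  define K where "K = cball 0 1 - ball (1::complex) (r / 2)"
  have "compact K" unfolding K_def by (intro compact_diff compact_cball open_ball)
  moreover have "f analytic_on K" by (rule analytic_on_subset[OF an]) (use r in \<open>auto simp: K_def\<close>)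
  then have "continuous_on K ((deriv ^^ 2) f)"
    by (intro holomorphic_on_imp_continuous_on analytic_imp_holomorphic analytic_higher_deriv)
  ultimately have "bounded ((deriv ^^ 2) f ` K)" by (intro compact_imp_bounded compact_continuous_image)
  then obtain B where B: "B > 0" "\<And>z. z \<in> K \<Longrightarrow> norm ((deriv ^^ 2) f z) \<le> B" by (auto simp: bounded_pos)
  show ?thesis
  proof (rule that[of B])
    fix z :: complex assume z: "norm z < 1"
    have *: "0 \<le> \<eta> * norm (1 - z) powr (- a - 2)" using eta by simp
    show "norm ((deriv ^^ 2) f z) \<le> B + \<eta> * norm (1 - z) powr (- a - 2)"
    proof (cases "norm (z - 1) < r / 2")
      case True
      with near_bound[OF z] B(1) show ?thesis by linarith
    next
      case False
      then have "z \<in> K" using z by (auto simp: K_def dist_norm norm_minus_commute)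
      with B(2) * show ?thesis by (meson add_increasing2)
    qed
  qed (use B in simp)
qed

lemma higher_deriv_2_coeff: "(deriv ^^ (m + 2)) f z = (deriv ^^ m) ((deriv ^^ 2) f) z"
  by (simp only: funpow_add o_apply)

text \<open>The n-th coefficient of \<open>f\<close> is the (n-2)-nd coefficient of the second
  derivative divided by n (n-1). On |z| = 1 - 1/n one has |1 - z| \<ge> 1/n, hence |1 - z|^(-a-2)
  \<le> n^a |1 - z|^(-2), and the mean of the right-hand side is at most n^(a+1). Without the
  derivatives the estimate fails for a < 1: the mean of |1 - z|^(-a) then stays bounded and yields
  no factor n^(a-1).\<close>

theorem transfer_little_o:
  fixes f :: "complex \<Rightarrow> complex" and a :: real
  assumes th: "0 < \<theta>" "\<theta> < pi / 2" and eps: "0 < \<epsilon>" and a: "0 \<le> a"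
    and an: "f analytic_on cball 0 1 - {1}"
    and near: "\<forall>\<^sub>F z in at 1 within delta_domain 1 \<epsilon> \<theta>. f analytic_on {z}"
    and lim: "((\<lambda>z. f z * (1 - z) powr of_real a) \<longlongrightarrow> 0) (at 1 within delta_domain 1 \<epsilon> \<theta>)"
  shows "(\<lambda>n. (deriv ^^ n) f 0 / fact n * of_real (real n powr (1 - a))) \<longlonglongrightarrow> 0"
proof (rule tendstoI)
  fix e :: real assume e: "e > 0"
  \<comment> \<open>The bound \<open>main\<close> is 8 \<eta> plus a null sequence, and 8 \<eta> = e
    / 2.\<close>
  define \<eta> where "\<eta> = e / 16"
  have eta: "\<eta> > 0" using e by (simp add: \<eta>_def)
  obtain B where B: "0 \<le> B"
    "\<And>z. norm z < 1 \<Longrightarrow> norm ((deriv ^^ 2) f z) \<le> B + \<eta> * norm (1 - z) powr (- a - 2)"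
    using deriv_2_bound_of_little_o[OF th eps a an near lim eta] by blast
  have main: "norm ((deriv ^^ n) f 0 / fact n * of_real (real n powr (1 - a)))
       \<le> 8 * B * real n powr (- 1 - a) + 8 * \<eta>" if n: "n \<ge> 2" for n
  proof -
    define R where "R = 1 - 1 / real n"
    have R: "0 < R" "R < 1" "R \<ge> 1 / 2" using n by (auto simp: R_def field_simps)
    obtain m where m: "n = m + 2" using n by (metis le_Suc_ex add.commute)
    have "norm ((deriv ^^ m) ((deriv ^^ 2) f) 0 / fact m)
        \<le> (B + \<eta> * real n powr a / (1 - R\<^sup>2)) / R ^ m"
    proof (rule higher_deriv_bound_poisson[OF R(1,2)])
      show "(deriv ^^ 2) f holomorphic_on ball 0 1"
        by (intro analytic_imp_holomorphic analytic_higher_deriv analytic_on_subset[OF an]) auto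
      fix z :: complex assume z: "norm z = R"
      have y: "norm (1 - z) \<ge> 1 / real n"
        using norm_triangle_ineq2[of 1 z] z by (simp add: R_def)
      then have y0: "norm (1 - z) > 0" using n by (smt (verit) divide_pos_pos of_nat_0_less_iff zero_less_numeral less_le_trans)
      have "norm (1 - z) powr (- a - 2) = norm (1 - z) powr (- a) / (norm (1 - z))\<^sup>2"
        using y0 by (simp add: powr_diff)
      also have "norm (1 - z) powr (- a) \<le> (1 / real n) powr (- a)"
        using y n a by (intro powr_mono2') auto
      also have "(1 / real n) powr (- a) = real n powr a"
        using n by (simp add: powr_divide powr_minus field_simps)
      finally have "norm (1 - z) powr (- a - 2) \<le> real n powr a / (norm (1 - z))\<^sup>2"
        by (simp add: divide_right_mono)
      then have "\<eta> * norm (1 - z) powr (- a - 2) \<le> \<eta> * (real n powr a / (norm (1 - z))\<^sup>2)"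
        using eta by (intro mult_left_mono) auto
      then show "norm ((deriv ^^ 2) f z) \<le> B + \<eta> * real n powr a / (norm (1 - z))\<^sup>2"
        using B(2)[of z] z R by simp
    qed
    also have "\<dots> \<le> (B + \<eta> * real n powr a / (1 / real n)) / (1 / 4)"
    proof -
      have "R\<^sup>2 \<le> R" using R by (simp add: power2_eq_square)
      then have 2: "1 / real n \<le> 1 - R\<^sup>2" by (simp add: R_def)
      have "0 < 1 - R\<^sup>2" using n by (intro less_le_trans[OF _ 2]) simp
      \<comment> \<open>Since n = m + 2, 1 / R = n / (n - 1), and (1 + 1/(m+1))^m stays below exp 1.
        So the factor R^(-m) on this circle costs only a constant.\<close>
      have "1 / R = 1 + 1 / (real m + 1)" by (simp add: R_def m field_simps)
      also have "\<dots> \<le> exp (1 / (real m + 1))" by (rule exp_ge_add_one_self)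
      finally have "(1 / R) ^ m \<le> exp (1 / (real m + 1)) ^ m" using R by (intro power_mono) auto
      also have "\<dots> = exp (real m / (real m + 1))" by (simp flip: exp_of_nat_mult)
      also have "\<dots> \<le> exp 1" by simp
      also have "\<dots> \<le> 4" using exp_le by simp
      finally have 3: "1 / 4 \<le> R ^ m" using R by (simp add: power_divide field_simps)
      have "\<eta> * real n powr a / (1 - R\<^sup>2) \<le> \<eta> * real n powr a / (1 / real n)"
        by (rule divide_left_mono[OF 2]) (use \<open>0 < 1 - R\<^sup>2\<close> eta n in auto)
      then show ?thesis using 3 eta B n by (intro frac_le) auto
    qed
    finally have 1: "norm ((deriv ^^ n) f 0 / fact m) \<le> 4 * B + 4 * \<eta> * real n powr a * real n"
      unfolding m higher_deriv_2_coeff by (simp add: field_simps)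
    have fact_n: "fact n = real n * (real n - 1) * fact m" unfolding m by (simp add: algebra_simps)
    have "norm ((deriv ^^ n) f 0 / fact n * of_real (real n powr (1 - a)))
       = norm ((deriv ^^ n) f 0 / fact m) * (real n powr (1 - a) / (real n * (real n - 1)))"
      using n by (simp add: norm_mult norm_divide fact_n abs_mult)
    also have "\<dots> \<le> (4 * B + 4 * \<eta> * real n powr a * real n) * (real n powr (1 - a) / (real n * (real n / 2)))"
      using n by (intro mult_mono 1 divide_left_mono) (use B eta in auto)
    also have "\<dots> = 8 * B * real n powr (- 1 - a) + 8 * \<eta>"
    proof -
      have 1: "real n powr (- 1 - a) = real n powr (1 - a) / (real n * real n)"
        using n by (simp add: powr_diff powr_minus field_simps)
      have 2: "real n powr a * real n powr (1 - a) = real n"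
        using n by (simp flip: powr_add)
      have "(4 * B + 4 * \<eta> * A * x) * (P / (x * (x / 2))) = 8 * B * (P / (x * x)) + 8 * \<eta> * (A * P / x)"
        if "x > 0" for A P x :: real using that by (simp add: field_simps)
      from this[of "real n" "real n powr a" "real n powr (1 - a)"] show ?thesis
        using n unfolding 1 2 by simp
    qed
    finally show ?thesis .
  qed
  have "(\<lambda>n. 8 * B * real n powr (- 1 - a) + 8 * \<eta>) \<longlonglongrightarrow> 8 * B * 0 + 8 * \<eta>"
    using a by (intro tendsto_intros tendsto_neg_powr filterlim_real_sequentially) auto
  then have "\<forall>\<^sub>F n in sequentially. 8 * B * real n powr (- 1 - a) + 8 * \<eta> < e"
    by (rule order_tendstoD) (use e in \<open>simp add: \<eta>_def\<close>)
  with eventually_ge_at_top[of 2] show "\<forall>\<^sub>F n in sequentially.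
      dist ((deriv ^^ n) f 0 / fact n * of_real (real n powr (1 - a))) 0 < e"
  proof eventually_elim
    case (elim n)
    have "norm ((deriv ^^ n) f 0 / fact n * of_real (real n powr (1 - a))) < e"
      using main[OF elim(1)] elim(2) by (rule le_less_trans)
    then show ?case by (simp only: dist_norm diff_zero)
  qed
qed

section \<open>Positive stable and Mittag-Leffler laws\<close>

definition sibuya_weight :: "real \<Rightarrow> nat \<Rightarrow> real" where
  "sibuya_weight \<alpha> k = (if k = 0 then 0 else - ((- 1) ^ k * (\<alpha> gchoose k)))"

lemma sibuya_weight_nonneg:
  assumes "0 < \<alpha>" "\<alpha> < 1"
  shows "0 \<le> sibuya_weight \<alpha> k"
proof (cases k)
  case (Suc j)
  have "sibuya_weight \<alpha> k = \<alpha> * pochhammer (1 - \<alpha>) j / fact k"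
    by (simp add: sibuya_weight_def Suc gbinomial_pochhammer pochhammer_rec power_mult_distrib[symmetric]
          flip: power_add mult.assoc)
  then show ?thesis using assms by (auto intro!: divide_nonneg_nonneg mult_nonneg_nonneg pochhammer_nonneg)
qed (simp add: sibuya_weight_def)

text \<open>The partial sums of the alternating binomials telescope to
  \<open>1 - (-1) ^ n * (\<alpha> - 1 gchoose n)\<close>, and by the Gamma asymptotics the
  subtracted term is of order n^(-\<alpha>).\<close>

lemma sibuya_weight_sums:
  assumes "0 < \<alpha>" "\<alpha> < 1"
  shows "sibuya_weight \<alpha> sums 1"
proof -
  let ?x = "\<lambda>n. (-1) ^ n * (\<alpha> - 1 gchoose n)"
  have "(\<lambda>n. ((\<alpha> - 1) gchoose n) / ((-1) ^ n / exp ((\<alpha> - 1 + 1) * of_real (ln (real n)))) * real n powr (- \<alpha>))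
    \<longlonglongrightarrow> inverse (Gamma (- (\<alpha> - 1))) * 0"
    by (intro tendsto_mult gbinomial_asymptotic tendsto_neg_powr filterlim_real_sequentially) (use assms in auto)
  moreover have "\<forall>\<^sub>F n in sequentially. ((\<alpha> - 1) gchoose n) / ((-1) ^ n / exp ((\<alpha> - 1 + 1) * of_real (ln (real n)))) * real n powr (- \<alpha>) = ?x n"
    using eventually_gt_at_top[of 0]
  proof eventually_elim
    case (elim n)
    then have "exp (\<alpha> * ln (real n)) * real n powr (- \<alpha>) = 1" by (simp add: powr_def flip: exp_add)
    then have "exp (\<alpha> * ln (real n)) * real n powr (- \<alpha>) * y = y" for y by simp
    from this[of "?x n"] show ?case by (cases "even n") (simp_all add: field_simps)
  qed
  ultimately have "?x \<longlonglongrightarrow> 0" by (simp add: filterlim_cong)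
  moreover have "sum (sibuya_weight \<alpha>) {..n} = 1 - ?x n" for n
  proof -
    have "sum (sibuya_weight \<alpha>) {..n} = (\<Sum>k\<le>n. (if k = 0 then 1 else 0) - (\<alpha> gchoose k) * (- 1) ^ k)"
      by (intro sum.cong) (auto simp: sibuya_weight_def)
    then show ?thesis by (simp add: sum_subtractf gbinomial_sum_lower_neg)
  qed
  moreover from calculation(1) have "(\<lambda>n. 1 - ?x n) \<longlonglongrightarrow> 1 - 0" by (intro tendsto_diff tendsto_const)
  ultimately show ?thesis by (simp add: sums_def_le)
qed

lemma sibuya_weight_pgf:
  assumes z: "0 \<le> z" "z < (1::real)"
  shows "(\<lambda>k. sibuya_weight \<alpha> k * z ^ k) sums (1 - (1 - z) powr \<alpha>)"
proof -
  have *: "(\<lambda>n. if n = 0 then 1 else 0) sums (1::real)"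
    using sums_single[of 0 "\<lambda>_. 1::real"] by simp
  have "(\<lambda>n. (if n = 0 then 1 else 0) - (\<alpha> gchoose n) * (- z) ^ n) sums (1 - (1 + (- z)) powr \<alpha>)"
    using z by (intro sums_diff gen_binomial_real *) simp
  moreover have "(if n = 0 then 1 else 0) - (\<alpha> gchoose n) * (- z) ^ n = sibuya_weight \<alpha> n * z ^ n" for n
    by (auto simp: sibuya_weight_def power_minus[of z])
  ultimately show ?thesis by simp
qed

definition sibuya_pmf :: "real \<Rightarrow> nat pmf" where
  "sibuya_pmf \<alpha> = embed_pmf (sibuya_weight \<alpha>)"

lemma pmf_sibuya:
  assumes "0 < \<alpha>" "\<alpha> < 1"
  shows "pmf (sibuya_pmf \<alpha>) k = sibuya_weight \<alpha> k"
  unfolding sibuya_pmf_def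
proof (rule pmf_embed_pmf)
  show "(\<integral>\<^sup>+k. ennreal (sibuya_weight \<alpha> k) \<partial>count_space UNIV) = 1"
    unfolding nn_integral_count_space_nat
    using suminf_ennreal_eq[OF sibuya_weight_nonneg[OF assms] sibuya_weight_sums[OF assms]] by simp
qed (use sibuya_weight_nonneg assms in auto)

primrec sibuya_sum_pmf :: "real \<Rightarrow> nat \<Rightarrow> nat pmf" where
  "sibuya_sum_pmf \<alpha> 0 = return_pmf 0"
| "sibuya_sum_pmf \<alpha> (Suc n) = map_pmf (\<lambda>(x, y). x + y) (pair_pmf (sibuya_pmf \<alpha>) (sibuya_sum_pmf \<alpha> n))"

lemma sibuya_sum_pgf:
  assumes al: "0 < \<alpha>" "\<alpha> < 1" and z: "0 \<le> z" "z < (1::real)"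
  shows "(\<integral>\<^sup>+k. ennreal (z ^ k) \<partial>sibuya_sum_pmf \<alpha> n) = ennreal ((1 - (1 - z) powr \<alpha>) ^ n)"
proof (induction n)
  case (Suc n)
  have nonneg: "0 \<le> 1 - (1 - z) powr \<alpha>" using z al by (simp add: powr_le1)
  have *: "(\<integral>\<^sup>+k. ennreal (z ^ k) \<partial>sibuya_pmf \<alpha>) = ennreal (1 - (1 - z) powr \<alpha>)"
    unfolding nn_integral_measure_pmf nn_integral_count_space_nat
    using z sibuya_weight_nonneg[OF al] sibuya_weight_pgf[OF z, of \<alpha>]
    by (auto simp: pmf_sibuya[OF al] intro!: suminf_ennreal_eq simp flip: ennreal_mult)
  have "(\<integral>\<^sup>+k. ennreal (z ^ k) \<partial>sibuya_sum_pmf \<alpha> (Suc n))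
     = (\<integral>\<^sup>+a. \<integral>\<^sup>+b. ennreal (z ^ a) * ennreal (z ^ b) \<partial>sibuya_sum_pmf \<alpha> n \<partial>sibuya_pmf \<alpha>)"
    using z by (simp add: nn_integral_pair_pmf' power_add ennreal_mult)
  also have "\<dots> = ennreal ((1 - (1 - z) powr \<alpha>) ^ Suc n)"
    using nonneg by (simp add: nn_integral_cmult nn_integral_multc Suc * ennreal_mult)
  finally show ?case .
qed simp

text \<open>For small u, 1 - (1 - e^(-u))^\<alpha> is close to 1 - u^\<alpha>. With u = t
  N^(-1/\<alpha>) its N-th power approaches exp (- t^\<alpha>), which dictates the scale; N =
  \<open>Suc n\<close> keeps it positive.\<close>

definition sibuya_scaled :: "real \<Rightarrow> nat \<Rightarrow> real measure" where
  "sibuya_scaled \<alpha> n = distr (sibuya_sum_pmf \<alpha> (Suc n)) borel (\<lambda>k. real k / real (Suc n) powr (1 / \<alpha>))"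

lemma real_distribution_sibuya_scaled: "real_distribution (sibuya_scaled \<alpha> n)"
  unfolding sibuya_scaled_def by (intro prob_space.real_distribution_distr measure_pmf.prob_space_axioms) auto

lemma AE_sibuya_scaled_nonneg: "AE x in sibuya_scaled \<alpha> n. 0 \<le> x"
  unfolding sibuya_scaled_def by (subst AE_distr_iff) auto

text \<open>\<open>max x 0\<close> agrees with x on the support and makes the integrand bounded and
  continuous on the whole real line, as weak convergence requires of a test function.\<close>

lemma laplace_sibuya_scaled:
  assumes al: "0 < \<alpha>" "\<alpha> < 1" and t: "0 < t"
  shows "(\<integral>x. exp (- (t * max x 0)) \<partial>sibuya_scaled \<alpha> n)
      = (1 - (1 - exp (- t / real (Suc n) powr (1 / \<alpha>))) powr \<alpha>) ^ Suc n"
proof -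
  define u where "u = t / real (Suc n) powr (1 / \<alpha>)"
  have u: "u > 0" using t by (simp add: u_def)
  have nonneg: "0 \<le> 1 - (1 - exp (- u)) powr \<alpha>" using u al by (simp add: powr_le1)
  have "(\<integral>x. exp (- (t * max x 0)) \<partial>sibuya_scaled \<alpha> n) = (\<integral>k. exp (- u) ^ k \<partial>sibuya_sum_pmf \<alpha> (Suc n))"
    unfolding sibuya_scaled_def
    by (subst integral_distr)
       (auto simp: max_absorb1 u_def mult.commute simp del: sibuya_sum_pmf.simps of_nat_Suc simp flip: exp_of_nat_mult
          intro!: Bochner_Integration.integral_cong)
  also have "\<dots> = enn2real (\<integral>\<^sup>+k. ennreal (exp (- u) ^ k) \<partial>sibuya_sum_pmf \<alpha> (Suc n))"
    by (intro integral_eq_nn_integral) auto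
  also have "\<dots> = (1 - (1 - exp (- u)) powr \<alpha>) ^ Suc n"
    using u nonneg by (subst sibuya_sum_pgf[OF al]) auto
  finally show ?thesis by (simp add: u_def)
qed

text \<open>With N = \<open>Suc n\<close>, N \<open>x n\<close> tends to t^\<alpha> and
  \<open>x n\<close> to 0. The inequalities e^(-x/(1-x)) \<le> 1 - x \<le> e^(-x) then enclose the
  N-th power between two sequences with the same limit.\<close>

lemma laplace_sibuya_scaled_tendsto:
  assumes "0 < \<alpha>" "\<alpha> < 1" and "0 < t"
  shows "(\<lambda>n. (1 - (1 - exp (- t / real (Suc n) powr (1 / \<alpha>))) powr \<alpha>) ^ Suc n) \<longlonglongrightarrow> exp (- (t powr \<alpha>))"
proof -
  define u where "u n = t / real (Suc n) powr (1 / \<alpha>)" for n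
  define x where "x n = (1 - exp (- u n)) powr \<alpha>" for n
  have u_pos: "u n > 0" for n using assms by (simp add: u_def)
  have "u \<longlonglongrightarrow> 0"
    using tendsto_mult[OF tendsto_const[of t] tendsto_neg_powr[of "- (1 / \<alpha>)" "\<lambda>n. real (Suc n)" sequentially]]
      assms filterlim_compose[OF filterlim_real_sequentially filterlim_Suc]
    by (simp add: u_def [abs_def] powr_minus divide_inverse)
  moreover have u_ne: "u n \<noteq> 0" for n using u_pos[of n] by simp
  ultimately have u: "filterlim u (at_right 0) sequentially"
    using u_pos u_ne unfolding filterlim_at by simp
  have "((\<lambda>u::real. (1 - exp (- u)) / u) \<longlongrightarrow> 1) (at_right 0)" by real_asymp
  from filterlim_compose[OF this u] have "(\<lambda>n. ((1 - exp (- u n)) / u n) powr \<alpha>) \<longlonglongrightarrow> 1 powr \<alpha>"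
    by (intro tendsto_powr) auto
  then have "(\<lambda>n. t powr \<alpha> * ((1 - exp (- u n)) / u n) powr \<alpha>) \<longlonglongrightarrow> t powr \<alpha> * 1"
    by (intro tendsto_mult tendsto_const) simp
  also have "(\<lambda>n. t powr \<alpha> * ((1 - exp (- u n)) / u n) powr \<alpha>) = (\<lambda>n. real (Suc n) * x n)"
  proof
    fix n
    have "u n powr \<alpha> = t powr \<alpha> / real (Suc n)"
      using assms by (simp add: u_def powr_divide powr_powr del: of_nat_Suc)
    then show "t powr \<alpha> * ((1 - exp (- u n)) / u n) powr \<alpha> = real (Suc n) * x n"
      using assms u_pos[of n] by (simp add: x_def powr_divide del: of_nat_Suc)
  qed
  finally have Nx: "(\<lambda>n. real (Suc n) * x n) \<longlonglongrightarrow> t powr \<alpha>" by simp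
  have "(\<lambda>n. (1 - exp (- u n)) powr \<alpha>) \<longlonglongrightarrow> (1 - exp (- 0)) powr \<alpha>"
    by (intro tendsto_powr2 tendsto_intros \<open>u \<longlonglongrightarrow> 0\<close>)
       (use assms u_pos in \<open>auto simp: less_imp_le\<close>)
  then have x0: "x \<longlonglongrightarrow> 0" by (simp add: x_def [abs_def])
  have x_nn: "0 \<le> x n" for n by (simp add: x_def)
  have x_less: "x n < 1" for n using u_pos[of n] assms powr_less_mono2[of \<alpha> "1 - exp (- u n)" 1] by (simp add: x_def)
  have "(\<lambda>n. (1 - x n) ^ Suc n) \<longlonglongrightarrow> exp (- (t powr \<alpha>))"
  proof (rule tendsto_sandwich)
    have "(\<lambda>n. exp (- (real (Suc n) * x n) / (1 - x n))) \<longlonglongrightarrow> exp (- (t powr \<alpha>) / (1 - 0))"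
      by (intro tendsto_intros Nx x0) simp
    then show "(\<lambda>n. exp (- (real (Suc n) * x n) / (1 - x n))) \<longlonglongrightarrow> exp (- (t powr \<alpha>))" by simp
    show "(\<lambda>n. exp (- (real (Suc n) * x n))) \<longlonglongrightarrow> exp (- (t powr \<alpha>))"
      by (intro tendsto_intros Nx)
    show "\<forall>\<^sub>F n in sequentially. exp (- (real (Suc n) * x n) / (1 - x n)) \<le> (1 - x n) ^ Suc n"
    proof (rule always_eventually, rule allI)
      fix n
      have "1 / (1 - x n) \<le> exp (x n / (1 - x n))"
        using exp_ge_add_one_self[of "x n / (1 - x n)"] x_less[of n] by (simp add: field_simps)
      then have "exp (- (x n / (1 - x n))) \<le> 1 - x n"
        using x_less[of n] by (simp add: exp_minus field_simps)
      then have "exp (- (x n / (1 - x n))) ^ Suc n \<le> (1 - x n) ^ Suc n" by (intro power_mono) auto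
      then show "exp (- (real (Suc n) * x n) / (1 - x n)) \<le> (1 - x n) ^ Suc n"
        by (simp del: of_nat_Suc power_Suc flip: exp_of_nat_mult)
    qed
    show "\<forall>\<^sub>F n in sequentially. (1 - x n) ^ Suc n \<le> exp (- (real (Suc n) * x n))"
    proof (rule always_eventually, rule allI)
      fix n
      have "(1 - x n) ^ Suc n \<le> exp (- x n) ^ Suc n"
        using exp_ge_add_one_self[of "- x n"] x_less[of n] by (intro power_mono) auto
      then show "(1 - x n) ^ Suc n \<le> exp (- (real (Suc n) * x n))"
        by (simp del: of_nat_Suc power_Suc flip: exp_of_nat_mult)
    qed
  qed
  then show ?thesis by (simp add: x_def u_def del: of_nat_Suc power_Suc)
qed

text \<open>From 1 - e^(-u) \<le> u and Bernoulli's inequality. The bound is uniform in n and thus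
  controls the tails of all the scaled sums at once.\<close>

lemma laplace_sibuya_scaled_ge:
  assumes al: "0 < \<alpha>" "\<alpha> < 1" and t: "0 < t"
  shows "1 - t powr \<alpha> \<le> (1 - (1 - exp (- t / real (Suc n) powr (1 / \<alpha>))) powr \<alpha>) ^ Suc n"
proof -
  define u where "u = t / real (Suc n) powr (1 / \<alpha>)"
  have u: "u > 0" using t by (simp add: u_def)
  have "1 - exp (- u) \<le> u" using exp_ge_add_one_self[of "- u"] by simp
  then have "(1 - exp (- u)) powr \<alpha> \<le> u powr \<alpha>" using u al by (intro powr_mono2) auto
  also have "u powr \<alpha> = t powr \<alpha> / real (Suc n)"
    using t al by (simp add: u_def powr_divide powr_powr)
  finally have "real (Suc n) * (1 - exp (- u)) powr \<alpha> \<le> t powr \<alpha>" by (simp add: field_simps)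
  moreover have "1 + real (Suc n) * (- ((1 - exp (- u)) powr \<alpha>)) \<le> (1 + - ((1 - exp (- u)) powr \<alpha>)) ^ Suc n"
    using u al by (intro Bernoulli_inequality) (simp add: powr_le1)
  ultimately show ?thesis by (simp add: u_def)
qed

lemma tight_sibuya_scaled:
  assumes al: "0 < \<alpha>" "\<alpha> < 1"
  shows "tight (sibuya_scaled \<alpha>)"
  unfolding tight_def
proof (intro conjI allI impI real_distribution_sibuya_scaled)
  fix \<epsilon> :: real assume eps: "\<epsilon> > 0"
  \<comment> \<open>The infimum of 1 - e^(-t x) over x > 1/t. Markov's inequality for 1 - e^(-t x)
    bounds the mass beyond b = 1/t by t^\<alpha> / d, and t is chosen to make this \<epsilon> /
    2.\<close>
  define d where "d = 1 - exp (- 1 :: real)"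
  have d: "d > 0" by (simp add: d_def)
  define t where "t = (\<epsilon> * d / 2) powr (1 / \<alpha>)"
  have t: "t > 0" "t powr \<alpha> = \<epsilon> * d / 2" using eps d al by (auto simp: t_def powr_powr)
  define b where "b = 1 / t"
  have b: "b > 0" using t by (simp add: b_def)
  \<comment> \<open>Only x \<ge> 0 is known almost surely, and the interval is open at its left end,
    so it starts at -1.\<close>
  have "measure (sibuya_scaled \<alpha> n) {-1<..b} > 1 - \<epsilon>" for n
  proof -
    interpret real_distribution "sibuya_scaled \<alpha> n" by (rule real_distribution_sibuya_scaled)
    have int: "integrable (sibuya_scaled \<alpha> n) (\<lambda>x. exp (- (t * max x 0)))"
      using t by (intro integrable_const_bound[of _ 1]) auto
    have "(\<integral>x. d * indicator {b<..} x \<partial>sibuya_scaled \<alpha> n) \<le> (\<integral>x. 1 - exp (- (t * max x 0)) \<partial>sibuya_scaled \<alpha> n)"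
    proof (intro integral_mono Bochner_Integration.integrable_diff int integrable_const)
      fix x show "d * indicator {b<..} x \<le> 1 - exp (- (t * max x 0))"
      proof (cases "x > b")
        case True
        then have "t * x > 1" using t by (simp add: b_def field_simps)
        moreover have "x > 0" using True b by simp
        ultimately show ?thesis using True by (simp add: d_def max_absorb1)
      qed (use t in simp)
    qed (auto intro!: integrable_mult_right integrable_real_indicator simp: emeasure_eq_measure)
    also have "\<dots> \<le> t powr \<alpha>"
      using int laplace_sibuya_scaled_ge[OF al t(1), of n] prob_space
      by (simp add: laplace_sibuya_scaled[OF al t(1)])
    finally have "d * prob {b<..} \<le> d * (\<epsilon> / 2)" unfolding t(2) by (simp add: mult.commute)
    then have 1: "prob {b<..} \<le> \<epsilon> / 2" using d by simp
    have "prob {0..} = 1" using AE_sibuya_scaled_nonneg[of \<alpha> n] by (subst prob_eq_1) auto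
    then have "1 \<le> prob ({-1<..b} \<union> {b<..})" by (intro order_trans[OF eq_refl[OF sym] finite_measure_mono]) auto
    also have "\<dots> = prob {-1<..b} + prob {b<..}" by (intro finite_measure_Union) auto
    finally show ?thesis using 1 eps by linarith
  qed
  moreover have "-1 < b" using b by simp
  ultimately show "\<exists>a b. a < b \<and> (\<forall>n. measure (sibuya_scaled \<alpha> n) {a<..b} > 1 - \<epsilon>)" by blast
qed

text \<open>Tightness yields a weak limit along a subsequence, which is enough for existence. Its
  Laplace transform is at first known only with \<open>max x 0\<close>, since the limit is not yet
  known to live on the positive axis.\<close>

theorem positive_stable_law_exists:
  assumes al: "0 < \<alpha>" "\<alpha> < 1"
  obtains S where "positive_stable_law \<alpha> S"
proof -
  obtain r S where r: "strict_mono r" and S: "real_distribution S"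
    and conv: "weak_conv_m (sibuya_scaled \<alpha> \<circ> id \<circ> r) S"
    using tight_imp_convergent_subsubsequence[OF tight_sibuya_scaled[OF al] strict_mono_id] by blast
  interpret S: real_distribution S by fact
  have lap: "(\<integral>x. exp (- (t * max x 0)) \<partial>S) = exp (- (t powr \<alpha>))" if t: "t > 0" for t
  proof (rule LIMSEQ_unique)
    have cont: "isCont (\<lambda>x. exp (- (t * max x 0))) x" for x :: real by (intro continuous_intros)
    show "(\<lambda>n. \<integral>x. exp (- (t * max x 0)) \<partial>(sibuya_scaled \<alpha> \<circ> id \<circ> r) n) \<longlonglongrightarrow> (\<integral>x. exp (- (t * max x 0)) \<partial>S)"
      by (rule weak_conv_imp_integral_bdd_continuous_conv[where B = 1, OF _ S conv])
         (use t cont in \<open>simp_all add: real_distribution_sibuya_scaled\<close>)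
    show "(\<lambda>n. \<integral>x. exp (- (t * max x 0)) \<partial>(sibuya_scaled \<alpha> \<circ> id \<circ> r) n) \<longlonglongrightarrow> exp (- (t powr \<alpha>))"
      using LIMSEQ_subseq_LIMSEQ[OF laplace_sibuya_scaled_tendsto[OF al t] r]
      by (simp add: laplace_sibuya_scaled[OF al t] o_def)
  qed
  \<comment> \<open>Letting t run to infinity through the integers isolates the mass of the
    half-line x \<le> 0; as exp (- t^\<alpha>) tends to 0, there is none.\<close>
  have "(\<lambda>n. \<integral>x. exp (- (real (Suc n) * max x 0)) \<partial>S) \<longlonglongrightarrow> (\<integral>x. indicator {..0} x \<partial>S)"
  proof (rule integral_dominated_convergence[where w = "\<lambda>_. 1"])
    show "AE x in S. (\<lambda>n. exp (- (real (Suc n) * max x 0))) \<longlonglongrightarrow> indicator {..0} x"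
    proof (rule AE_I2)
      fix x :: real show "(\<lambda>n. exp (- (real (Suc n) * max x 0))) \<longlonglongrightarrow> indicator {..0} x"
      proof (cases "x \<le> 0")
        case False
        then have "x > 0" by simp
        then have "(\<lambda>n. exp (- (real (Suc n) * x))) \<longlonglongrightarrow> 0" by real_asymp
        then show ?thesis using False by (simp add: max_def)
      qed (auto simp: max_def)
    qed
  qed auto
  moreover have "(\<lambda>n. exp (- (real (Suc n) powr \<alpha>))) \<longlonglongrightarrow> 0"
    using al by real_asymp
  then have "(\<lambda>n. \<integral>x. exp (- (real (Suc n) * max x 0)) \<partial>S) \<longlonglongrightarrow> 0"
    by (simp add: lap del: of_nat_Suc)
  ultimately have "(\<integral>x. indicator {..0} x \<partial>S) = (0::real)" by (rule LIMSEQ_unique)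
  then have "S.prob {..0} = 0" by simp
  then have pos: "AE x in S. 0 < x" by (subst (asm) S.prob_eq_0) auto
  have "(\<integral>x. exp (- (t * x)) \<partial>S) = exp (- (t powr \<alpha>))" if t: "t \<ge> 0" for t
  proof (cases "t = 0")
    case True
    then show ?thesis using S.prob_space by simp
  next
    case False
    then have "(\<integral>x. exp (- (t * max x 0)) \<partial>S) = exp (- (t powr \<alpha>))" using t lap by simp
    also have "(\<integral>x. exp (- (t * max x 0)) \<partial>S) = (\<integral>x. exp (- (t * x)) \<partial>S)"
    proof (rule integral_cong_AE)
      show "AE x in S. exp (- (t * max x 0)) = exp (- (t * x))"
        using pos by (rule eventually_mono) (simp add: max_absorb1)
    qed auto
    finally show ?thesis .
  qed
  then show ?thesis using S pos that unfolding positive_stable_law_def by blast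
qed

text \<open>The substitution v = t^\<alpha> turns the integral into Gamma (m + 1) /
  \<alpha>.\<close>

lemma stable_moment_integral:
  assumes al: "0 < \<alpha>"
  shows "(\<integral>\<^sup>+t. ennreal (indicator {0<..} t * (t powr (\<alpha> * real (Suc m) - 1) * exp (- (t powr \<alpha>)))) \<partial>lborel)
           = ennreal (fact m / \<alpha>)"
proof -
  \<comment> \<open>The product of e^(-v) with the exponential series truncated after v^m / m! has
    derivative - e^(-v) v^m / m!, because all other terms telescope. So \<open>F\<close> composed
    with t^\<alpha> is an antiderivative of the integrand.\<close>
  define F where "F v = - (fact m / \<alpha>) * (exp (- v) * (\<Sum>j\<le>m. v ^ j / fact j))" for v :: real
  let ?f = "\<lambda>t. t powr (\<alpha> * real (Suc m) - 1) * exp (- (t powr \<alpha>))"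
  have sum_deriv: "((\<lambda>v. \<Sum>j\<le>k. v ^ j / fact j) has_real_derivative (\<Sum>j\<le>k. v ^ j / fact j) - v ^ k / fact k) (at v)"
    for k and v :: real
  proof (induction k)
    case (Suc k)
    have "((\<lambda>v. v ^ Suc k / fact (Suc k)) has_real_derivative v ^ k / fact k) (at v)"
      using DERIV_cdivide[OF DERIV_pow[of "Suc k" v], of "fact (Suc k)"] by (simp del: of_nat_Suc)
    from DERIV_add[OF Suc this] show ?case by simp
  qed simp
  have F_deriv: "(F has_real_derivative (1 / \<alpha>) * exp (- v) * v ^ m) (at v)" for v
    unfolding F_def
    by (rule derivative_eq_intros sum_deriv refl)+ (simp add: field_simps)
  have deriv: "((\<lambda>t. F (t powr \<alpha>)) has_real_derivative ?f t) (at t)" if t: "t > 0" for t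
  proof -
    have "((\<lambda>t. F (t powr \<alpha>)) has_real_derivative
        ((1 / \<alpha>) * exp (- (t powr \<alpha>)) * (t powr \<alpha>) ^ m) * (\<alpha> * t powr (\<alpha> - 1))) (at t)"
      using t by (intro DERIV_chain2[OF F_deriv] has_real_derivative_powr)
    also have "((1 / \<alpha>) * exp (- (t powr \<alpha>)) * (t powr \<alpha>) ^ m) * (\<alpha> * t powr (\<alpha> - 1)) = ?f t"
    proof -
      have "(t powr \<alpha>) ^ m * t powr (\<alpha> - 1) = t powr (\<alpha> * real (Suc m) - 1)"
        using t by (simp add: powr_powr powr_add[symmetric] algebra_simps flip: powr_realpow)
      then show ?thesis using al by (simp add: field_simps)
    qed
    finally show ?thesis .
  qed
  have cont: "isCont ?f t" if "t > 0" for t using that by (auto intro!: continuous_intros)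
  have F_lim: "((\<lambda>v. F v) \<longlongrightarrow> 0) at_top"
  proof -
    have "((\<lambda>v. - (fact m / \<alpha>) * (\<Sum>j\<le>m. (v ^ j / exp v) / fact j)) \<longlongrightarrow> - (fact m / \<alpha>) * (\<Sum>j\<le>m. 0 / fact j)) at_top"
      by (intro tendsto_intros tendsto_power_div_exp_0) auto
    then show ?thesis
      by (simp add: F_def exp_minus divide_inverse sum_distrib_left mult_ac)
  qed
  have lim0: "(((\<lambda>t. F (t powr \<alpha>)) \<circ> real_of_ereal) \<longlongrightarrow> - (fact m / \<alpha>)) (at_right (ereal 0))"
  proof -
    have "(\<Sum>j\<le>m. 0 ^ j / fact j) = (\<Sum>j\<le>m. if j = 0 then 1 else (0::real))"
      by (intro sum.cong) auto
    then have "F 0 = - (fact m / \<alpha>)" by (simp add: F_def)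
    moreover have "((\<lambda>t. F (t powr \<alpha>)) \<longlongrightarrow> F (0 powr \<alpha>)) (at_right 0)"
      by (intro isCont_tendsto_compose[OF DERIV_isCont[OF F_deriv]] tendsto_powr2 tendsto_intros)
         (use al in \<open>auto simp: eventually_at_filter\<close>)
    ultimately show ?thesis using al by (simp add: ereal_tendsto_simps)
  qed
  have lim1: "(((\<lambda>t. F (t powr \<alpha>)) \<circ> real_of_ereal) \<longlongrightarrow> 0) (at_left \<infinity>)"
  proof -
    have "filterlim (\<lambda>t. t powr \<alpha>) at_top (at_top :: real filter)" using al by real_asymp
    then have "((\<lambda>t. F (t powr \<alpha>)) \<longlongrightarrow> 0) at_top" by (rule filterlim_compose[OF F_lim])
    then show ?thesis by (simp add: ereal_tendsto_simps)
  qed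
  have *: "set_integrable lborel (einterval (ereal 0) \<infinity>) ?f" "(LBINT t=ereal 0..\<infinity>. ?f t) = 0 - - (fact m / \<alpha>)"
    by (rule interval_integral_FTC_nonneg[where F = "\<lambda>t. F (t powr \<alpha>)", OF _ _ _ _ lim0 lim1]; use deriv cont in simp)+
  have "(\<integral>\<^sup>+t. ennreal (indicator {0<..} t * ?f t) \<partial>lborel) = ennreal (\<integral>t. indicator {0<..} t * ?f t \<partial>lborel)"
    using *(1) by (intro nn_integral_eq_integral) (auto simp: set_integrable_def)
  also have "(\<integral>t. indicator {0<..} t * ?f t \<partial>lborel) = fact m / \<alpha>"
    using *(2) by (simp add: interval_lebesgue_integral_def set_lebesgue_integral_def)
  finally show ?thesis .
qed

text \<open>Represents x^(-p) as a mixture of the functions exp (- t x), so that a negative moment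
  can be read off a Laplace transform.\<close>

lemma Gamma_scaled_nn_integral:
  assumes x: "0 < x" and p: "0 < p"
  shows "(\<integral>\<^sup>+t. ennreal (indicator {0<..} t * t powr (p - 1) * exp (- (t * x))) \<partial>lborel) = ennreal (Gamma p * x powr (- p))"
proof -
  have "ennreal (Gamma p) = (\<integral>\<^sup>+t. ennreal (indicator {0..} t * t powr (p - 1) / exp t) \<partial>lborel)"
    by (rule Gamma_conv_nn_integral_real[OF p])
  also have "\<dots> = ennreal \<bar>x\<bar> * (\<integral>\<^sup>+t. ennreal (indicator {0..} (0 + x * t) * (0 + x * t) powr (p - 1) / exp (0 + x * t)) \<partial>lborel)"
    by (rule nn_integral_real_affine) (use x in auto)
  also have "\<dots> = (\<integral>\<^sup>+t. ennreal x * ennreal (indicator {0..} (0 + x * t) * (0 + x * t) powr (p - 1) / exp (0 + x * t)) \<partial>lborel)"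
    using x by (subst nn_integral_cmult) auto
  also have "\<dots> = (\<integral>\<^sup>+t. ennreal (x powr p) * ennreal (indicator {0<..} t * t powr (p - 1) * exp (- (t * x))) \<partial>lborel)"
  proof (rule nn_integral_cong_AE, rule AE_mp[OF AE_lborel_singleton[of 0]], rule AE_I2, rule impI)
    fix t :: real assume "t \<noteq> 0"
    then show "ennreal x * ennreal (indicator {0..} (0 + x * t) * (0 + x * t) powr (p - 1) / exp (0 + x * t))
       = ennreal (x powr p) * ennreal (indicator {0<..} t * t powr (p - 1) * exp (- (t * x)))"
      using x by (cases "t > 0")
       (auto simp: indicator_def zero_le_mult_iff powr_mult powr_diff exp_minus field_simps simp flip: ennreal_mult)
  qed
  also have "\<dots> = ennreal (x powr p) * (\<integral>\<^sup>+t. ennreal (indicator {0<..} t * t powr (p - 1) * exp (- (t * x))) \<partial>lborel)"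
    by (rule nn_integral_cmult) auto
  finally have *: "ennreal (Gamma p) = ennreal (x powr p) * (\<integral>\<^sup>+t. ennreal (indicator {0<..} t * t powr (p - 1) * exp (- (t * x))) \<partial>lborel)" (is "_ = _ * ?I") .
  have "ennreal (Gamma p * x powr (- p)) = ennreal (x powr (- p)) * (ennreal (x powr p) * ?I)"
    unfolding *[symmetric] using p by (simp add: ennreal_mult Gamma_real_pos less_imp_le mult.commute)
  also have "\<dots> = (ennreal (x powr (- p)) * ennreal (x powr p)) * ?I" by (simp only: mult.assoc)
  also have "ennreal (x powr (- p)) * ennreal (x powr p) = 1"
    using x by (simp flip: ennreal_mult powr_add)
  finally show ?thesis by simp
qed

text \<open>Stated with nonnegative integrals: their order may then be exchanged without an
  integrability condition, and the finiteness of the moment comes out together with its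
  value.\<close>

lemma positive_stable_law_negative_moment:
  assumes S: "positive_stable_law \<alpha> S" and al: "0 < \<alpha>"
  shows "(\<integral>\<^sup>+x. ennreal (x powr (- (\<alpha> * real s))) \<partial>S) = ennreal (Gamma (real s + 1) / Gamma (real s * \<alpha> + 1))"
proof (cases s)
  \<comment> \<open>For s = 0 the exponent \<alpha> s is 0, outside the range of the Gamma
    integral.\<close>
  case 0
  interpret real_distribution S using S by (simp add: positive_stable_law_def)
  have "AE x in S. 0 < x" using S by (simp add: positive_stable_law_def)
  then have "(\<integral>\<^sup>+x. ennreal (x powr (- (\<alpha> * real s))) \<partial>S) = (\<integral>\<^sup>+x. 1 \<partial>S)"
    by (intro nn_integral_cong_AE) (auto simp: 0)
  then show ?thesis using emeasure_space_1 by (simp add: 0)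
next
  case (Suc m)
  interpret real_distribution S using S by (simp add: positive_stable_law_def)
  interpret pair_sigma_finite S lborel ..
  have pos: "AE x in S. 0 < x" and lap: "\<And>t. t \<ge> 0 \<Longrightarrow> (\<integral>x. exp (- (t * x)) \<partial>S) = exp (- (t powr \<alpha>))"
    using S by (auto simp: positive_stable_law_def)
  define p where "p = \<alpha> * real (Suc m)"
  have p: "p > 0" using al by (simp add: p_def)
  let ?g = "\<lambda>x t. ennreal (indicator {0<..} t * t powr (p - 1) * exp (- (t * x)))"
  have "ennreal (Gamma p) * (\<integral>\<^sup>+x. ennreal (x powr (- p)) \<partial>S) = (\<integral>\<^sup>+x. ennreal (Gamma p * x powr (- p)) \<partial>S)"
    using p by (subst nn_integral_cmult[symmetric]) (auto simp: ennreal_mult Gamma_real_pos less_imp_le)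
  also have "\<dots> = (\<integral>\<^sup>+x. \<integral>\<^sup>+t. ?g x t \<partial>lborel \<partial>S)"
    by (rule nn_integral_cong_AE) (use pos p in \<open>auto simp: Gamma_scaled_nn_integral elim!: eventually_mono\<close>)
  also have "\<dots> = (\<integral>\<^sup>+t. \<integral>\<^sup>+x. ?g x t \<partial>S \<partial>lborel)"
    by (rule Fubini'[symmetric]) measurable
  also have "\<dots> = (\<integral>\<^sup>+t. ennreal (indicator {0<..} t * (t powr (p - 1) * exp (- (t powr \<alpha>)))) \<partial>lborel)"
  proof (rule nn_integral_cong)
    fix t :: real
    show "(\<integral>\<^sup>+x. ?g x t \<partial>S) = ennreal (indicator {0<..} t * (t powr (p - 1) * exp (- (t powr \<alpha>))))"
    proof (cases "t > 0")
      case True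
      have int: "integrable S (\<lambda>x. exp (- (t * x)))"
        by (rule integrable_const_bound[of _ 1]) (use True pos in \<open>auto elim!: eventually_mono\<close>)
      have "(\<integral>\<^sup>+x. ?g x t \<partial>S) = ennreal (t powr (p - 1)) * (\<integral>\<^sup>+x. ennreal (exp (- (t * x))) \<partial>S)"
        using True by (subst nn_integral_cmult[symmetric]) (auto simp: ennreal_mult)
      also have "(\<integral>\<^sup>+x. ennreal (exp (- (t * x))) \<partial>S) = ennreal (exp (- (t powr \<alpha>)))"
        using True by (subst nn_integral_eq_integral[OF int]) (auto simp: lap)
      finally show ?thesis using True by (simp add: ennreal_mult)
    qed simp
  qed
  also have "\<dots> = ennreal (fact m / \<alpha>)" unfolding p_def by (rule stable_moment_integral[OF al])
  finally have *: "ennreal (Gamma p) * (\<integral>\<^sup>+x. ennreal (x powr (- p)) \<partial>S) = ennreal (fact m / \<alpha>)" (is "_ * ?I = _") .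
  have "ennreal (1 / Gamma p) * ennreal (Gamma p) = 1"
    using Gamma_real_pos[OF p] by (simp flip: ennreal_mult)
  then have "?I = (ennreal (1 / Gamma p) * ennreal (Gamma p)) * ?I" by simp
  also have "\<dots> = ennreal (1 / Gamma p) * ennreal (fact m / \<alpha>)" by (simp only: mult.assoc *)
  also have "\<dots> = ennreal (1 / Gamma p * (fact m / \<alpha>))"
    using p al Gamma_real_pos[OF p] by (simp flip: ennreal_mult)
  also have "1 / Gamma p * (fact m / \<alpha>) = Gamma (real s + 1) / Gamma (real s * \<alpha> + 1)"
  proof -
    have "Gamma (real s * \<alpha> + 1) = p * Gamma p"
      using p Gamma_plus1[of p] nonpos_Ints_nonpos[of p] by (force simp: p_def Suc mult.commute)
    moreover have "Gamma (real s + 1) = real s * fact m"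
      using Gamma_fact[of s, where 'a = real] by (simp add: Suc add.commute)
    moreover have "1 / G * (F / \<alpha>) = r * F / (\<alpha> * r * G)" if "r > 0" "G > 0" for r F G :: real
      using that al by simp
    ultimately show ?thesis using Gamma_real_pos[OF p] by (simp add: p_def Suc del: of_nat_Suc)
  qed
  finally show ?thesis by (simp add: p_def Suc)
qed

theorem mittag_leffler_law_exists:
  fixes \<alpha> :: real
  assumes al: "0 < \<alpha>" "\<alpha> < 1"
  shows "\<exists>L. mittag_leffler_law \<alpha> L \<and> real_distribution L \<and>
           (\<forall>s::nat. has_bochner_integral L (\<lambda>x. x ^ s) (Gamma (real s + 1) / Gamma (real s * \<alpha> + 1)))"
proof -
  obtain S where S: "positive_stable_law \<alpha> S" using positive_stable_law_exists[OF al] .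
  interpret real_distribution S using S by (simp add: positive_stable_law_def)
  have pos: "AE x in S. 0 < x" using S by (auto simp: positive_stable_law_def)
  define L where "L = distr S borel (\<lambda>x. x powr (- \<alpha>))"
  have ae: "AE x in S. (x powr (- \<alpha>)) ^ s = x powr (- (\<alpha> * real s))" for s
    by (rule AE_mp[OF pos], rule AE_I2) (simp add: powr_powr flip: powr_realpow)
  have hbi: "has_bochner_integral S (\<lambda>x. x powr (- (\<alpha> * real s))) (Gamma (real s + 1) / Gamma (real s * \<alpha> + 1))" for s
    using positive_stable_law_negative_moment[OF S al(1), of s] al
    by (intro has_bochner_integral_nn_integral) (auto intro!: divide_nonneg_nonneg less_imp_le[OF Gamma_real_pos] add_nonneg_pos)
  have hb: "has_bochner_integral S (\<lambda>x. (x powr (- \<alpha>)) ^ s) (Gamma (real s + 1) / Gamma (real s * \<alpha> + 1))" for s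
    by (subst has_bochner_integral_cong_AE[OF _ _ ae]) (auto intro: hbi)
  have "has_bochner_integral L (\<lambda>x. x ^ s) (Gamma (real s + 1) / Gamma (real s * \<alpha> + 1))" for s
    unfolding L_def by (intro has_bochner_integral_distr) (auto intro: hb simp: o_def)
  moreover have "mittag_leffler_law \<alpha> L" unfolding mittag_leffler_law_def L_def using S by blast
  moreover have "real_distribution L" unfolding L_def by simp
  ultimately show ?thesis by blast
qed

section \<open>The method of moments\<close>

text \<open>Taylor's formula for a characteristic function at an even order N has a remainder of at
  most 2 |t|^N / N! times the N-th moment, since even moments are absolute moments.
  \<open>growth\<close> makes the remainder of \<open>L\<close> small, convergence of the N-th
  moment carries this over to \<open>M n\<close>, and the Taylor polynomials converge. So
  \<open>growth\<close> takes the place of a determinacy criterion.\<close>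

theorem weak_conv_m_of_moments:
  fixes M :: "nat \<Rightarrow> real measure"
  assumes M: "\<And>n. real_distribution (M n)" and L: "real_distribution L"
    and int_M: "\<And>n k. integrable (M n) (\<lambda>x. x ^ k)" and int_L: "\<And>k. integrable L (\<lambda>x. x ^ k)"
    and conv: "\<And>k. (\<lambda>n. \<integral>x. x ^ k \<partial>M n) \<longlonglongrightarrow> (\<integral>x. x ^ k \<partial>L)"
    and growth: "\<And>t. (\<lambda>k. t ^ (2 * k) / fact (2 * k) * (\<integral>x. x ^ (2 * k) \<partial>L)) \<longlonglongrightarrow> 0"
  shows "weak_conv_m M L"
proof (rule levy_continuity[OF M L])
  fix t :: real
  show "(\<lambda>n. char (M n) t) \<longlonglongrightarrow> char L t"
  proof (rule tendstoI)
    fix e :: real assume e: "e > 0"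
    \<comment> \<open>The quarter: the remainder constant carries a factor 2, and a remainder occurs
      once for \<open>M n\<close> and once for \<open>L\<close>.\<close>
    have "\<forall>\<^sub>F k in sequentially. t ^ (2 * k) / fact (2 * k) * (\<integral>x. x ^ (2 * k) \<partial>L) < e / 4"
      using growth[of t] by (rule order_tendstoD) (use e in simp)
    then obtain k where k: "t ^ (2 * k) / fact (2 * k) * (\<integral>x. x ^ (2 * k) \<partial>L) < e / 4"
      by (auto simp: eventually_sequentially)
    define N where "N = 2 * k"
    define P where "P \<nu> = (\<Sum>j\<le>N. ((\<i> * t) ^ j / fact j) * complex_of_real (\<integral>x. x ^ j \<partial>\<nu>))" for \<nu> :: "real measure"
    define C where "C = 2 * \<bar>t\<bar> ^ N / fact N"
    have C: "C = 2 * (t ^ (2 * k) / fact (2 * k))" by (simp add: C_def N_def power_even_abs)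
    have approx: "norm (char \<nu> t - P \<nu>) \<le> C * (\<integral>x. x ^ N \<partial>\<nu>)"
      if "real_distribution \<nu>" "\<And>k. integrable \<nu> (\<lambda>x. x ^ k)" for \<nu>
      using real_distribution.char_approx1[OF that(1), of N t] that(2)
      by (simp add: P_def C_def N_def power_even_abs)
    have le: "norm (char (M n) t - char L t) \<le> C * (\<integral>x. x ^ N \<partial>M n) + norm (P (M n) - P L) + C * (\<integral>x. x ^ N \<partial>L)" for n
    proof -
      have "char (M n) t - char L t = (char (M n) t - P (M n)) + (P (M n) - P L) - (char L t - P L)" by simp
      also have "norm \<dots> \<le> norm (char (M n) t - P (M n)) + norm (P (M n) - P L) + norm (char L t - P L)"
        by (rule order_trans[OF norm_triangle_ineq4 add_right_mono[OF norm_triangle_ineq]])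
      finally show ?thesis using approx[OF M int_M, of n] approx[OF L int_L] by linarith
    qed
    have "(\<lambda>n. C * (\<integral>x. x ^ N \<partial>M n) + norm (P (M n) - P L) + C * (\<integral>x. x ^ N \<partial>L))
        \<longlonglongrightarrow> C * (\<integral>x. x ^ N \<partial>L) + norm (P L - P L) + C * (\<integral>x. x ^ N \<partial>L)"
      unfolding P_def by (intro tendsto_intros conv)
    moreover have "C * (\<integral>x. x ^ N \<partial>L) + norm (P L - P L) + C * (\<integral>x. x ^ N \<partial>L) < e"
      using k by (simp add: C N_def mult_ac)
    ultimately have "\<forall>\<^sub>F n in sequentially. C * (\<integral>x. x ^ N \<partial>M n) + norm (P (M n) - P L) + C * (\<integral>x. x ^ N \<partial>L) < e"
      by (rule order_tendstoD(2))
    then show "\<forall>\<^sub>F n in sequentially. dist (char (M n) t) (char L t) < e"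
      by eventually_elim (use le in \<open>auto simp: dist_norm intro: le_less_trans\<close>)
  qed
qed

text \<open>Only t \<ge> A is kept in the integral, where t^x \<ge> A^x. As A is free, Gamma
  outgrows every exponential.\<close>

lemma Gamma_plus1_ge:
  fixes A x :: real
  assumes "0 < A" "0 \<le> x"
  shows "A powr x * exp (- A) \<le> Gamma (x + 1)"
proof (rule has_integral_le)
  show "((\<lambda>t. t powr (x + 1 - 1) / exp t) has_integral Gamma (x + 1)) {0..}"
    by (rule Gamma_integral_real) (use assms in simp)
  have "((\<lambda>t. A powr x * exp (- 1 * t)) has_integral A powr x * (exp (- 1 * A) / 1)) {A..}"
    by (intro has_integral_mult_right has_integral_exp_minus_to_infinity) simp
  then show "((\<lambda>t. if t \<in> {A..} then A powr x * exp (- t) else 0) has_integral A powr x * exp (- A)) {0..}"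
    using assms by (subst has_integral_restrict) auto
  show "(if t \<in> {A..} then A powr x * exp (- t) else 0) \<le> t powr (x + 1 - 1) / exp t" if "t \<in> {0..}" for t
    using assms that by (auto simp: exp_minus divide_inverse intro!: mult_right_mono powr_mono2)
qed

lemma power_over_Gamma_tendsto_0:
  fixes \<alpha> t :: real
  assumes al: "0 < \<alpha>"
  shows "(\<lambda>k. t ^ k / Gamma (real k * \<alpha> + 1)) \<longlonglongrightarrow> 0"
proof (rule Lim_null_comparison)
  \<comment> \<open>\<open>B\<close> makes |t| / B at most 1/2, and \<open>A\<close> is the number
    with A^(k \<alpha>) = B^k.\<close>
  define B where "B = 2 * (\<bar>t\<bar> + 1)"
  define A where "A = B powr (1 / \<alpha>)"
  have B: "B > 0" by (simp add: B_def)
  have A: "A > 0" using B by (simp add: A_def)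
  show "(\<lambda>k. exp A * (1 / 2) ^ k) \<longlonglongrightarrow> 0"
    by (intro tendsto_mult_right_zero LIMSEQ_realpow_zero) auto
  show "\<forall>\<^sub>F k in sequentially. norm (t ^ k / Gamma (real k * \<alpha> + 1)) \<le> exp A * (1 / 2) ^ k"
  proof (intro always_eventually allI)
    fix k
    have "A powr (real k * \<alpha>) = B ^ k"
      using B al by (simp add: A_def powr_powr powr_realpow)
    then have "B ^ k * exp (- A) \<le> Gamma (real k * \<alpha> + 1)"
      using Gamma_plus1_ge[OF A, of "real k * \<alpha>"] al by simp
    moreover have pos: "0 < B ^ k * exp (- A)" using B by simp
    ultimately have "\<bar>t\<bar> ^ k / Gamma (real k * \<alpha> + 1) \<le> \<bar>t\<bar> ^ k / (B ^ k * exp (- A))"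
      by (intro frac_le) auto
    also have "\<dots> = exp A * (\<bar>t\<bar> / B) ^ k" by (simp add: exp_minus power_divide field_simps)
    also have "\<dots> \<le> exp A * (1 / 2) ^ k"
      by (intro mult_left_mono power_mono) (auto simp: B_def field_simps)
    finally show "norm (t ^ k / Gamma (real k * \<alpha> + 1)) \<le> exp A * (1 / 2) ^ k"
      using al by (simp add: power_abs abs_of_pos Gamma_real_pos add_nonneg_pos)
  qed
qed

text \<open>Multiplying the falling factorial of length j by k gives the one of length j + 1 plus j
  times the one of length j. The last term lacks one factor \<open>b n\<close> and vanishes in the
  limit. Mixed moments, with j arbitrary, are what makes the induction on s go through.\<close>

lemma moments_of_factorial_moments:
  fixes w :: "nat \<Rightarrow> nat \<Rightarrow> real" and b :: "nat \<Rightarrow> real"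
  assumes b: "filterlim b at_top sequentially"
    and fm: "\<And>s. (\<lambda>n. (\<Sum>k\<le>n. w n k * (\<Prod>i<s. real k - real i)) / b n ^ s) \<longlonglongrightarrow> \<mu> s"
  shows "(\<lambda>n. (\<Sum>k\<le>n. w n k * (real k ^ s * (\<Prod>i<j. real k - real i))) / b n ^ (s + j)) \<longlonglongrightarrow> \<mu> (s + j)"
proof (induction s arbitrary: j)
  case 0
  show ?case using fm by simp
next
  case (Suc s)
  let ?E = "\<lambda>j n. (\<Sum>k\<le>n. w n k * (real k ^ s * (\<Prod>i<j. real k - real i))) / b n ^ (s + j)"
  have "(\<lambda>n. ?E (Suc j) n + real j * (?E j n * inverse (b n))) \<longlonglongrightarrow> \<mu> (s + Suc j) + real j * (\<mu> (s + j) * 0)"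
    by (intro tendsto_intros Suc tendsto_inverse_0_at_top b)
  moreover have "?E (Suc j) n + real j * (?E j n * inverse (b n))
      = (\<Sum>k\<le>n. w n k * (real k ^ Suc s * (\<Prod>i<j. real k - real i))) / b n ^ (Suc s + j)" for n
  proof -
    have "w n k * (real k ^ Suc s * (\<Prod>i<j. real k - real i))
       = w n k * (real k ^ s * (\<Prod>i<Suc j. real k - real i)) + real j * (w n k * (real k ^ s * (\<Prod>i<j. real k - real i)))" for k
      by (simp add: algebra_simps)
    then have "(\<Sum>k\<le>n. w n k * (real k ^ Suc s * (\<Prod>i<j. real k - real i)))
       = (\<Sum>k\<le>n. w n k * (real k ^ s * (\<Prod>i<Suc j. real k - real i)))
        + real j * (\<Sum>k\<le>n. w n k * (real k ^ s * (\<Prod>i<j. real k - real i)))"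
      by (simp only: sum.distrib sum_distrib_left)
    then show ?thesis by (simp add: divide_inverse algebra_simps del: prod.lessThan_Suc)
  qed
  ultimately show ?case by simp
qed

text \<open>Only point probabilities are known. Those up to n already sum to 1, so the variable is
  almost surely at most n and its expectations are finite sums.\<close>

lemma (in prob_space) has_bochner_integral_of_finite_range:
  fixes X :: "'a \<Rightarrow> nat" and f :: "nat \<Rightarrow> real"
  assumes X: "X \<in> measurable M (count_space UNIV)"
    and total: "(\<Sum>k\<le>n. prob {\<omega> \<in> space M. X \<omega> = k}) = 1"
  shows "has_bochner_integral M (\<lambda>\<omega>. f (X \<omega>)) (\<Sum>k\<le>n. prob {\<omega> \<in> space M. X \<omega> = k} * f k)"
proof -
  let ?A = "\<lambda>k. {\<omega> \<in> space M. X \<omega> = k}"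
  have A: "?A k \<in> events" for k using X by measurable
  have "{\<omega> \<in> space M. X \<omega> \<le> n} = (\<Union>k\<in>{..n}. ?A k)" by auto
  moreover have "prob (\<Union>k\<in>{..n}. ?A k) = (\<Sum>k\<le>n. prob (?A k))"
    using A by (intro finite_measure_finite_Union) (auto simp: disjoint_family_on_def)
  ultimately have "prob {\<omega> \<in> space M. X \<omega> \<le> n} = 1" using total by simp
  moreover have "{\<omega> \<in> space M. X \<omega> \<le> n} \<in> events" using X by measurable
  ultimately have ae: "AE \<omega> in M. X \<omega> \<le> n" by (simp add: prob_Collect_eq_1)
  have "has_bochner_integral M (\<lambda>\<omega>. \<Sum>k\<le>n. indicator (?A k) \<omega> * f k) (\<Sum>k\<le>n. prob (?A k) * f k)"
    by (intro has_bochner_integral_sum has_bochner_integral_mult_left has_bochner_integral_real_indicator A)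
       (auto simp: emeasure_eq_measure)
  moreover have "AE \<omega> in M. (\<Sum>k\<le>n. indicator (?A k) \<omega> * f k) = f (X \<omega>)"
    using ae AE_space
  proof eventually_elim
    case (elim \<omega>)
    then have "(\<Sum>k\<le>n. indicator (?A k) \<omega> * f k) = (\<Sum>k\<le>n. if k = X \<omega> then f k else 0)"
      by (intro sum.cong) (auto simp: indicator_def)
    then show ?case using elim by simp
  qed
  ultimately show ?thesis
    by (subst has_bochner_integral_cong_AE[symmetric]) (use X in \<open>auto simp: eq_commute\<close>)
qed

section \<open>Singularity analysis of the critical scheme\<close>

lemma has_fps_expansion_of_sums:
  fixes f :: "complex \<Rightarrow> complex"
  assumes r: "0 < r" and sums: "\<And>z. norm z < r \<Longrightarrow> (\<lambda>n. a n * z ^ n) sums f z"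
  shows "f has_fps_expansion Abs_fps a"
  unfolding has_fps_expansion_def
proof
  have "norm (complex_of_real (r / 2)) \<le> conv_radius a"
    by (rule conv_radius_geI, rule sums_summable[OF sums]) (use r in auto)
  then show "0 < fps_conv_radius (Abs_fps a)"
    using r by (auto simp: fps_conv_radius_def zero_ereal_def elim!: less_le_trans[rotated])
  have "\<forall>\<^sub>F z in nhds 0. z \<in> ball 0 r"
    using r by (intro eventually_nhds_in_open) auto
  then show "\<forall>\<^sub>F z in nhds 0. eval_fps (Abs_fps a) z = f z"
    by eventually_elim (use sums in \<open>auto simp: eval_fps_def intro: sums_unique[symmetric]\<close>)
qed

lemma of_real_fps_power_nth:
  "(Abs_fps (\<lambda>n. complex_of_real (p n)) ^ k) $ n = complex_of_real ((Abs_fps p ^ k) $ n)"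
  by (induction k arbitrary: n) (auto simp: fps_mult_nth)

lemma of_real_fps_compose_nth:
  "fps_compose (Abs_fps (\<lambda>n. complex_of_real (a n))) (Abs_fps (\<lambda>n. complex_of_real (p n))) $ n
     = complex_of_real (\<Sum>k\<le>n. a k * (Abs_fps p ^ k) $ n)"
  by (simp add: fps_compose_nth of_real_fps_power_nth atLeast0AtMost)

text \<open>Multiplication by \<open>1 - fps_X\<close> takes differences of coefficients, so
  Pascal's rule reads \<open>(1 - fps_X) * B (Suc m) = fps_X * B m\<close>, the recursion obeyed by
  the powers of X / (1 - X). The case k = 0 is separate because k - 1 truncates to 0, and
  \<open>0 choose 0\<close> is 1.\<close>

lemma geometric_power_nth:
  fixes k m :: nat
  shows "(Abs_fps (\<lambda>k. if k = 0 then 0 else 1 :: 'a :: idom) ^ Suc m) $ k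
           = (if k = 0 then 0 else of_nat ((k - 1) choose m))"
proof -
  let ?A = "Abs_fps (\<lambda>k. if k = 0 then 0 else 1 :: 'a)"
  define B where "B m = Abs_fps (\<lambda>k. if k = 0 then 0 else of_nat ((k - 1) choose m) :: 'a)" for m
  have A: "(1 - fps_X) * ?A = fps_X"
    by (rule fps_ext) (simp add: left_diff_distrib)
  have B: "(1 - fps_X) * B (Suc m) = fps_X * B m" for m
  proof (rule fps_ext)
    fix n
    have "(1 - fps_X) * B (Suc m) = B (Suc m) - fps_X * B (Suc m)" by (simp add: algebra_simps)
    then show "((1 - fps_X) * B (Suc m)) $ n = (fps_X * B m) $ n"
    proof (cases n)
      case (Suc i)
      then show ?thesis using \<open>(1 - fps_X) * B (Suc m) = _\<close> by (cases i) (auto simp: B_def)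
    qed (simp add: B_def)
  qed
  have X: "(1 - fps_X :: 'a fps) \<noteq> 0"
  proof
    assume "(1 - fps_X :: 'a fps) = 0"
    then have "(1 - fps_X :: 'a fps) $ 0 = 0" by simp
    then show False by simp
  qed
  have "?A ^ Suc m = B m"
  proof (induction m)
    case (Suc m)
    have "(1 - fps_X) * ?A ^ Suc (Suc m) = ((1 - fps_X) * ?A) * ?A ^ Suc m" by (simp only: power_Suc mult.assoc)
    also have "\<dots> = (1 - fps_X) * B (Suc m)" by (simp only: A Suc B)
    finally show ?case using X by (simp only: mult_cancel_left) simp
  qed (auto simp: B_def intro!: fps_ext)
  then show ?thesis by (simp add: B_def)
qed

text \<open>The factor \<open>Suc j\<close> cancels the 1/k of the logarithmic series at k =
  \<open>Suc j\<close>; what remains is \<open>fact m\<close> times the coefficient in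
  \<open>geometric_power_nth\<close>.\<close>

lemma falling_factorial_Suc:
  "(\<Prod>i<Suc m. real (Suc j) - real i) = real (Suc j) * (fact m * real (j choose m))"
proof -
  have "(\<Prod>i<m. real j - real i) = fact m * real (j choose m)"
    by (simp add: binomial_gbinomial gbinomial_prod_rev atLeast0LessThan)
  then show ?thesis by (subst prod.lessThan_Suc_shift) simp
qed

lemma one_minus_powr_has_fps_expansion:
  "(\<lambda>z. (1 - z) powr a) has_fps_expansion Abs_fps (\<lambda>n. (- 1) ^ n * (a gchoose n))" for a :: complex
proof (rule has_fps_expansion_of_sums[of 1])
  fix z :: complex assume "norm z < 1"
  then have "(\<lambda>n. (a gchoose n) * (- z) ^ n) sums (1 + (- z)) powr a" by (intro gen_binomial_complex) simp
  then show "(\<lambda>n. (- 1) ^ n * (a gchoose n) * z ^ n) sums (1 - z) powr a"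
    by (simp add: power_minus[of z] mult_ac)
qed simp

lemma Ln_one_minus_has_fps_expansion:
  "(\<lambda>z. - Ln (1 - z)) has_fps_expansion Abs_fps (\<lambda>n. complex_of_real (if n = 0 then 0 else 1 / real n))"
proof (rule has_fps_expansion_of_sums[of 1])
  fix z :: complex assume "norm z < 1"
  then have "(\<lambda>n. - (- ((- (- z)) ^ n) / of_nat n)) sums - ln (1 + (- z))"
    by (intro sums_minus Ln_series') simp
  also have "(\<lambda>n. - (- ((- (- z)) ^ n) / of_nat n)) = (\<lambda>n. complex_of_real (if n = 0 then 0 else 1 / real n) * z ^ n)"
    by auto
  finally show "(\<lambda>n. complex_of_real (if n = 0 then 0 else 1 / real n) * z ^ n) sums - Ln (1 - z)" by simp
qed simp

lemma geometric_has_fps_expansion: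
  "(\<lambda>z. z / (1 - z)) has_fps_expansion Abs_fps (\<lambda>k. if k = 0 then 0 else 1 :: complex)"
proof (rule has_fps_expansion_of_sums[of 1])
  fix z :: complex assume z: "norm z < 1"
  have "(\<lambda>n. z ^ n - (if n = 0 then 1 else 0)) sums (1 / (1 - z) - 1)"
    by (intro sums_diff geometric_sums z) (use sums_single[of 0 "\<lambda>_. 1::complex"] in simp)
  moreover have "z \<noteq> 1" using z by auto
  then have "1 / (1 - z) - 1 = z / (1 - z)" by (simp add: field_simps)
  ultimately have "(\<lambda>n. z ^ n - (if n = 0 then 1 else 0)) sums (z / (1 - z))" by simp
  then show "(\<lambda>n. (if n = 0 then 0 else 1) * z ^ n) sums (z / (1 - z))"
    by (rule back_subst[of "\<lambda>f. f sums _"]) auto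
qed simp

lemma one_minus_notin_nonpos_Reals:
  assumes "z \<in> delta_domain 1 \<epsilon> \<theta>" "0 < \<theta>"
  shows "1 - z \<notin> \<real>\<^sub>\<le>\<^sub>0"
proof
  assume "1 - z \<in> \<real>\<^sub>\<le>\<^sub>0"
  then obtain r where "r \<le> 0" "1 - z = of_real r" by (auto elim: nonpos_Reals_cases)
  then have "z - 1 = of_real (- r)" "0 \<le> - r" by (auto simp: algebra_simps)
  then have "Arg (z - 1) = 0" by (metis Arg_of_real not_less)
  then show False using assms by (simp add: delta_domain_def)
qed

lemma fps_power_nth_scale:
  "(Abs_fps (\<lambda>n. h n * r ^ n) ^ k) $ n = (Abs_fps h ^ k) $ n * r ^ n" for r :: "'a :: comm_ring_1"
proof (induction k arbitrary: n)
  case (Suc k)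
  have "h i * r ^ i * ((Abs_fps h ^ k) $ (n - i) * r ^ (n - i)) = h i * (Abs_fps h ^ k) $ (n - i) * r ^ n"
    if "i \<le> n" for i
  proof -
    have "r ^ n = r ^ i * r ^ (n - i)" using that by (simp flip: power_add)
    then show ?thesis by (simp add: mult_ac)
  qed
  then show ?case by (simp add: fps_mult_nth Suc sum_distrib_right)
qed auto

text \<open>The singularity is scaled to 1: \<open>p n\<close> is \<open>h n * \<rho> ^ n\<close> and \<open>G z\<close> is \<open>H (\<rho> * z)\<close>.\<close>
locale critical_scheme =
  fixes p :: "nat \<Rightarrow> real" and G :: "complex \<Rightarrow> complex" and \<epsilon> \<theta> lam c :: real
  assumes p_nonneg: "\<And>n. 0 \<le> p n"
    and p_0: "p 0 = 0"
    and G_series: "\<And>z. norm z < 1 \<Longrightarrow> (\<lambda>n. of_real (p n) * z ^ n) sums G z"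
    and eps: "0 < \<epsilon>"
    and theta: "0 < \<theta>" "\<theta> < pi / 2"
    and G_analytic: "G analytic_on delta_domain 1 \<epsilon> \<theta>"
    and lambda: "0 < lam" "lam < 1"
    and c_nonzero: "c \<noteq> 0"
    and G_expansion: "((\<lambda>z. (1 - G z) / (1 - z) powr of_real lam) \<longlongrightarrow> - of_real c)
                        (at 1 within delta_domain 1 \<epsilon> \<theta>)"
begin

abbreviation "\<Delta> \<equiv> delta_domain 1 \<epsilon> \<theta>"

section \<open>Values of \<open>G\<close> on the closed unit disc\<close>

lemma in_\<Delta>: "norm z \<le> 1 \<Longrightarrow> z \<noteq> 1 \<Longrightarrow> z \<in> \<Delta>"
  using delta_domain_contains_cball[OF theta eps] by blast

lemma G_analytic_at: "z \<in> \<Delta> \<Longrightarrow> G analytic_on {z}"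
  using G_analytic analytic_on_analytic_at by blast

definition g :: "real \<Rightarrow> real" where "g t = (\<Sum>n. p n * t ^ n)"

lemma g_sums: assumes "\<bar>t\<bar> < 1" shows "(\<lambda>n. p n * t ^ n) sums g t"
proof -
  have "(\<lambda>n. complex_of_real (p n * t ^ n)) sums G (of_real t)"
    using G_series[of "of_real t"] assms by simp
  then have "summable (\<lambda>n. complex_of_real (p n * t ^ n))" by (rule sums_summable)
  then have "summable (\<lambda>n. p n * t ^ n)" by (simp only: summable_of_real_iff)
  then show ?thesis unfolding g_def by (rule summable_sums)
qed

lemma G_of_real: assumes "\<bar>t\<bar> < 1" shows "G (of_real t) = of_real (g t)"
proof (rule sums_unique2)
  show "(\<lambda>n. of_real (p n) * of_real t ^ n) sums G (of_real t)" using G_series assms by simp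
  show "(\<lambda>n. of_real (p n) * of_real t ^ n) sums complex_of_real (g t)"
    using g_sums[OF assms] by (simp flip: of_real_power of_real_mult add: sums_of_real_iff)
qed

lemma g_mono: assumes "0 \<le> s" "s \<le> t" "t < 1" shows "g s \<le> g t"
  by (rule sums_le[OF _ g_sums g_sums]) (use assms p_nonneg in \<open>auto intro!: mult_left_mono power_mono\<close>)

lemma eventually_at_left_1: "\<forall>\<^sub>F t in at_left (1::real). 0 < t \<and> t < 1"
  unfolding eventually_at_left_field by (intro exI[of _ 0]) auto

lemma g_asymp: "((\<lambda>t. (1 - g t) / (1 - t) powr lam) \<longlongrightarrow> - c) (at_left 1)"
proof -
  have "filterlim complex_of_real (at 1 within \<Delta>) (at_left 1)"
    unfolding filterlim_at
    using eventually_at_left_1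
    by (auto intro!: tendsto_eq_intros in_\<Delta> elim!: eventually_mono)
  from filterlim_compose[OF G_expansion this]
  have "((\<lambda>t. (1 - G (of_real t)) / (1 - of_real t) powr of_real lam) \<longlongrightarrow> complex_of_real (- c)) (at_left 1)" by simp
  moreover have "\<forall>\<^sub>F t in at_left 1. (1 - G (of_real t)) / (1 - of_real t) powr of_real lam =
      complex_of_real ((1 - g t) / (1 - t) powr lam)"
    using eventually_at_left_1
  proof eventually_elim
    case (elim t)
    have "(1 - complex_of_real t) powr of_real lam = of_real ((1 - t) powr lam)"
      using elim powr_of_real[of "1 - t" lam] by simp
    then show ?case using elim by (simp add: G_of_real)
  qed
  ultimately have "((\<lambda>t. complex_of_real ((1 - g t) / (1 - t) powr lam)) \<longlongrightarrow> complex_of_real (- c)) (at_left 1)"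
    by (rule Lim_transform_eventually)
  then show ?thesis by (simp only: tendsto_of_real_iff)
qed

lemma g_tendsto: "(g \<longlongrightarrow> 1) (at_left 1)"
proof -
  have "((\<lambda>t. 1 - (1 - g t) / (1 - t) powr lam * (1 - t) powr lam) \<longlongrightarrow> 1 - (- c) * 0) (at_left 1)"
    by (intro tendsto_diff tendsto_const tendsto_mult g_asymp) (use lambda in real_asymp)
  moreover have "\<forall>\<^sub>F t in at_left 1. 1 - (1 - g t) / (1 - t) powr lam * (1 - t) powr lam = g t"
    using eventually_at_left_1 by eventually_elim simp
  ultimately show ?thesis by (simp add: filterlim_cong)
qed

lemma g_le_1: assumes "0 \<le> t" "t < 1" shows "g t \<le> 1"
proof (rule tendsto_lowerbound[OF g_tendsto])
  have "\<forall>\<^sub>F x in at_left 1. x \<in> {t<..<1}" using assms by (intro eventually_at_leftI[of t]) auto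
  then show "\<forall>\<^sub>F x in at_left 1. g t \<le> g x" by eventually_elim (use assms in \<open>auto intro: g_mono\<close>)
qed simp

text \<open>\<open>g\<close> increases to 1 on [0, 1), so the quotient with limit - c is
  nonnegative.\<close>

lemma c_neg: "c < 0"
proof -
  have "0 \<le> - c"
  proof (rule tendsto_lowerbound[OF g_asymp])
    show "\<forall>\<^sub>F t in at_left 1. 0 \<le> (1 - g t) / (1 - t) powr lam"
      using eventually_at_left_1 by eventually_elim (use g_le_1 in \<open>auto intro!: divide_nonneg_nonneg\<close>)
  qed simp
  then show ?thesis using c_nonzero by simp
qed

text \<open>Strictness comes from c < 0: some x to the right of t has g x < 1, and \<open>g\<close>
  is monotone.\<close>

lemma g_less_1: assumes "0 \<le> t" "t < 1" shows "g t < 1"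
proof -
  have "\<forall>\<^sub>F x in at_left 1. 0 < (1 - g x) / (1 - x) powr lam"
    using g_asymp by (rule order_tendstoD) (use c_neg in simp)
  moreover have "\<forall>\<^sub>F x in at_left 1. x \<in> {t<..<1}" using assms by (intro eventually_at_leftI[of t]) auto
  ultimately have "\<forall>\<^sub>F x in at_left 1. 0 < (1 - g x) / (1 - x) powr lam \<and> x \<in> {t<..<1}"
    by (rule eventually_conj)
  then obtain x where x: "0 < (1 - g x) / (1 - x) powr lam" "x \<in> {t<..<1}"
    using eventually_happens'[of "at_left (1::real)"] by auto
  then have "0 < 1 - g x" by (auto simp: zero_less_divide_iff)
  then show ?thesis using g_mono[of t x] x assms by auto
qed

lemma norm_G_less_1: assumes "norm z < 1" shows "norm (G z) < 1"
proof -
  have "norm (G z) \<le> g (norm z)"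
  proof (rule norm_sums_le[OF G_series[OF assms] g_sums])
    show "norm (of_real (p n) * z ^ n) \<le> p n * norm z ^ n" for n
      using p_nonneg by (simp add: norm_mult norm_power)
  qed (use assms in simp)
  also have "\<dots> < 1" using assms by (intro g_less_1) auto
  finally show ?thesis .
qed

text \<open>If \<open>Re (G z) \<ge> 1\<close> at another point of the unit circle, then \<open>z ^ n = 1\<close> for all
  \<open>n\<close> in the support of \<open>p\<close>, so \<open>G (t z) = G t\<close> and \<open>G\<close> has at \<open>z\<close> the same singularity as at \<open>1\<close>.\<close>
lemma Re_G_less_1_boundary:
  assumes z: "norm z = 1" "z \<noteq> 1"
  shows "Re (G z) < 1"
proof (rule ccontr)
  assume "\<not> Re (G z) < 1"
  then have ge: "1 \<le> Re (G z)" by simp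
  obtain D where D: "(G has_field_derivative D) (at z)"
    using analytic_derivI[OF G_analytic_at[OF in_\<Delta>]] z by force
  have lim_z: "filterlim (\<lambda>t. of_real t * z) (at z) (at_left (1::real))"
    unfolding filterlim_at using eventually_at_left_1 z
    by (auto intro!: tendsto_eq_intros elim!: eventually_mono)
  have G_lim: "((\<lambda>t. G (of_real t * z)) \<longlongrightarrow> G z) (at_left (1::real))"
    by (rule filterlim_compose[OF _ lim_z]) (use DERIV_isCont[OF D] in \<open>simp add: isCont_def\<close>)
  have root: "p k = 0 \<or> z ^ k = 1" for k
  proof -
    \<comment> \<open>The terms p n t^n (1 - Re (z^n)) are nonnegative and add up to g t - Re (G (t
      z)). One of them is kept and t tends to 1; with Re (G z) \<ge> 1 this forces p k = 0 or Re
      (z^k) = 1.\<close>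
    have "p k * (1 - Re (z ^ k)) \<le> 1 - Re (G z) - (1 - 1)"
    proof (rule tendsto_le)
      show "((\<lambda>t. p k * t ^ k * (1 - Re (z ^ k))) \<longlongrightarrow> p k * (1 - Re (z ^ k))) (at_left 1)"
        by (auto intro!: tendsto_eq_intros)
      show "((\<lambda>t. 1 - Re (G (of_real t * z)) - (1 - g t)) \<longlongrightarrow> 1 - Re (G z) - (1 - 1)) (at_left 1)"
        by (intro tendsto_intros G_lim g_tendsto)
      show "\<forall>\<^sub>F t in at_left 1. p k * t ^ k * (1 - Re (z ^ k)) \<le> 1 - Re (G (of_real t * z)) - (1 - g t)"
        using eventually_at_left_1
      proof eventually_elim
        case (elim t)
        have "(\<lambda>n. Re (of_real (p n) * (of_real t * z) ^ n)) sums Re (G (of_real t * z))"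
          by (intro sums_Re G_series) (use elim z in \<open>auto simp: norm_mult\<close>)
        then have "(\<lambda>n. p n * t ^ n - Re (of_real (p n) * (of_real t * z) ^ n)) sums (g t - Re (G (of_real t * z)))"
          by (intro sums_diff g_sums) (use elim in auto)
        also have "(\<lambda>n. p n * t ^ n - Re (of_real (p n) * (of_real t * z) ^ n)) = (\<lambda>n. p n * t ^ n * (1 - Re (z ^ n)))"
          by (simp add: power_mult_distrib algebra_simps flip: of_real_power)
        finally have sums: "(\<lambda>n. p n * t ^ n * (1 - Re (z ^ n))) sums (g t - Re (G (of_real t * z)))" .
        have "Re (z ^ n) \<le> 1" for n using complex_Re_le_cmod[of "z ^ n"] z by (simp add: norm_power)
        then have "0 \<le> p n * t ^ n * (1 - Re (z ^ n))" for n using p_nonneg[of n] elim by simp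
        then have "sum (\<lambda>n. p n * t ^ n * (1 - Re (z ^ n))) {k} \<le> g t - Re (G (of_real t * z))"
          unfolding sums_unique[OF sums] by (intro sum_le_suminf sums_summable[OF sums]) auto
        then show ?case by simp
      qed
    qed simp
    then have le: "p k * (1 - Re (z ^ k)) \<le> 0" using ge by simp
    have nz: "norm (z ^ k) = 1" using z by (simp add: norm_power)
    show ?thesis
    proof (cases "p k = 0")
      case False
      then have "1 \<le> Re (z ^ k)" using le p_nonneg[of k] by (simp add: mult_le_0_iff)
      then have "Re (z ^ k) = 1" using complex_Re_le_cmod[of "z ^ k"] nz by simp
      moreover from this have "Im (z ^ k) = 0" using nz cmod_power2[of "z ^ k"] by simp
      ultimately show ?thesis by (simp add: complex_eq_iff)
    qed simp
  qed
  have G_eq: "G (of_real t * z) = of_real (g t)" if "0 < t" "t < 1" for t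
  proof (rule sums_unique2)
    show "(\<lambda>n. of_real (p n) * (of_real t * z) ^ n) sums G (of_real t * z)"
      by (rule G_series) (use that z in \<open>simp add: norm_mult\<close>)
    have "(\<lambda>n. complex_of_real (p n * t ^ n)) sums of_real (g t)"
      using g_sums[of t] that by (simp only: sums_of_real_iff)
    moreover have "of_real (p n) * (of_real t * z) ^ n = complex_of_real (p n * t ^ n)" for n
      using root[of n] by (auto simp: power_mult_distrib)
    ultimately show "(\<lambda>n. of_real (p n) * (of_real t * z) ^ n) sums complex_of_real (g t)" by (simp only:)
  qed
  have "((\<lambda>t. complex_of_real (g t)) \<longlongrightarrow> G z) (at_left 1)"
    using G_lim by (rule Lim_transform_eventually) (use eventually_at_left_1 G_eq in \<open>auto elim!: eventually_mono\<close>)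
  moreover have "((\<lambda>t. complex_of_real (g t)) \<longlongrightarrow> of_real 1) (at_left 1)" by (intro tendsto_of_real g_tendsto)
  ultimately have G_z: "G z = 1" using tendsto_unique by force
  \<comment> \<open>Differentiability of \<open>G\<close> at z would make 1 - g t of order at most 1
    - t, whereas it is of order (1 - t)^lam. The factor (1 - t)^(1 - lam) turns the difference
    quotient into the quotient of \<open>g_asymp\<close>, whose limit would then be 0.\<close>
  have "((\<lambda>t. (G (of_real t * z) - G z) / (of_real t * z - z)) \<longlongrightarrow> D) (at_left (1::real))"
    using filterlim_compose[OF D[unfolded has_field_derivative_iff] lim_z] .
  then have "((\<lambda>t. norm ((G (of_real t * z) - G z) / (of_real t * z - z)) * (1 - t) powr (1 - lam)) \<longlongrightarrow> norm D * 0) (at_left (1::real))"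
    by (intro tendsto_mult tendsto_norm) (assumption, use lambda in real_asymp)
  moreover have "\<forall>\<^sub>F t in at_left (1::real). norm ((G (of_real t * z) - G z) / (of_real t * z - z)) * (1 - t) powr (1 - lam)
       = (1 - g t) / (1 - t) powr lam"
    using eventually_at_left_1
  proof eventually_elim
    case (elim t)
    have "norm (G (of_real t * z) - G z) = norm (complex_of_real (g t - 1))"
      using elim by (simp add: G_eq G_z)
    then have 1: "norm (G (of_real t * z) - G z) = 1 - g t"
      using g_le_1[of t] elim by (simp only: norm_of_real) simp
    have "of_real t * z - z = of_real (t - 1) * z" by (simp add: algebra_simps)
    then have "norm (of_real t * z - z) = 1 - t"
      using elim z by (simp only: norm_mult norm_of_real) simp
    then show ?case using 1 elim by (simp add: norm_divide powr_diff)
  qed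
  ultimately have "((\<lambda>t. (1 - g t) / (1 - t) powr lam) \<longlongrightarrow> norm D * 0) (at_left 1)"
    by (rule Lim_transform_eventually)
  then have "norm D * 0 = - c" using tendsto_unique[OF _ _ g_asymp] by force
  then show False using c_nonzero by simp
qed

lemma Re_G_less_1: "norm z \<le> 1 \<Longrightarrow> z \<noteq> 1 \<Longrightarrow> Re (G z) < 1"
  using Re_G_less_1_boundary[of z] norm_G_less_1[of z] complex_Re_le_cmod[of "G z"] by force

section \<open>Behaviour near the singularity\<close>

definition \<kappa> :: real where "\<kappa> = 1 / (- c)"

lemma kappa_pos: "0 < \<kappa>" using c_neg by (simp add: \<kappa>_def)

text \<open>The ratio of \<open>1 - G\<close> to its leading term (1 - z)^lam / \<kappa>. The
  estimates near 1 below all rest on \<open>q\<close> tending to 1.\<close>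

definition q :: "complex \<Rightarrow> complex" where
  "q z = of_real \<kappa> * ((1 - G z) / (1 - z) powr of_real lam)"

lemma q_tendsto: "(q \<longlongrightarrow> 1) (at 1 within \<Delta>)"
proof -
  have "(q \<longlongrightarrow> of_real \<kappa> * (- of_real c)) (at 1 within \<Delta>)"
    unfolding q_def by (intro tendsto_mult tendsto_const G_expansion)
  then show ?thesis using c_nonzero by (simp add: \<kappa>_def)
qed

lemma one_minus_G_eq:
  assumes "z \<noteq> 1" shows "1 - G z = q z * (1 - z) powr of_real lam / of_real \<kappa>"
  using assms kappa_pos by (simp add: q_def)

lemma eventually_in_\<Delta>: "\<forall>\<^sub>F z in at 1 within \<Delta>. z \<in> \<Delta> \<and> z \<noteq> 1"
  by (simp add: eventually_at_filter)

lemma G_tendsto: "(G \<longlongrightarrow> 1) (at 1 within \<Delta>)"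
proof -
  have 0: "((\<lambda>z. (1 - z) powr of_real lam) \<longlongrightarrow> (0::complex)) (at 1 within \<Delta>)"
  proof (rule tendsto_norm_zero_cancel)
    have "((\<lambda>z. norm (1 - z) powr lam) \<longlongrightarrow> norm (1 - 1 :: complex) powr lam) (at 1 within \<Delta>)"
      by (intro tendsto_powr2 tendsto_intros) (use lambda in auto)
    then show "((\<lambda>z. norm ((1 - z) powr complex_of_real lam)) \<longlongrightarrow> 0) (at 1 within \<Delta>)"
      by (simp add: norm_powr_real_powr')
  qed
  have "((\<lambda>z. 1 - q z * (1 - z) powr of_real lam / of_real \<kappa>) \<longlongrightarrow> 1 - 1 * 0 / of_real \<kappa>) (at 1 within \<Delta>)"
    by (intro tendsto_intros q_tendsto 0) (use kappa_pos in simp)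
  moreover have "\<forall>\<^sub>F z in at 1 within \<Delta>. 1 - q z * (1 - z) powr of_real lam / of_real \<kappa> = G z"
    using eventually_in_\<Delta> by eventually_elim (simp flip: one_minus_G_eq)
  ultimately show ?thesis by (simp add: filterlim_cong)
qed

text \<open>The argument of \<open>(1 - z) powr lam\<close> stays below \<open>lam * pi < pi\<close>, so the principal
  logarithms add up near the singularity.\<close>
lemma eventually_Ln_one_minus_G:
  "\<forall>\<^sub>F z in at 1 within \<Delta>. 1 - G z \<notin> \<real>\<^sub>\<le>\<^sub>0 \<and>
      Ln (1 - G z) = of_real lam * Ln (1 - z) - of_real (ln \<kappa>) + Ln (q z)"
proof -
  have "((\<lambda>z. Im (Ln (q z))) \<longlongrightarrow> Im (Ln 1)) (at 1 within \<Delta>)"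
    by (intro tendsto_intros q_tendsto) simp
  \<comment> \<open>The slack (1 - lam) pi keeps Im w strictly between - pi and pi. This yields at
    once the sum formula for the logarithms and that exp w avoids the cut.\<close>
  then have "\<forall>\<^sub>F z in at 1 within \<Delta>. \<bar>Im (Ln (q z))\<bar> < (1 - lam) * pi"
    using lambda by (auto dest!: tendstoD[where e = "(1 - lam) * pi"] simp: dist_real_def)
  moreover have "\<forall>\<^sub>F z in at 1 within \<Delta>. dist (q z) 1 < 1"
    using tendstoD[OF q_tendsto] by simp
  ultimately show ?thesis using eventually_in_\<Delta>
  proof eventually_elim
    case (elim z)
    have q0: "q z \<noteq> 0" using elim(2) by auto
    define w where "w = of_real lam * Ln (1 - z) - of_real (ln \<kappa>) + Ln (q z)"
    have "1 - G z = exp w"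
      using q0 elim kappa_pos one_minus_G_eq[of z]
      by (simp add: w_def powr_def exp_add exp_diff exp_of_real mult.commute)
    have "\<bar>Im (Ln (1 - z))\<bar> \<le> pi"
      using mpi_less_Im_Ln[of "1 - z"] Im_Ln_le_pi[of "1 - z"] elim by (auto simp: abs_le_iff)
    then have "\<bar>lam * Im (Ln (1 - z))\<bar> \<le> lam * pi" using lambda by (simp add: abs_mult)
    then have Im_w: "\<bar>Im w\<bar> < pi"
    proof -
      have "Im w = lam * Im (Ln (1 - z)) + Im (Ln (q z))" by (simp add: w_def)
      moreover have "(1 - lam) * pi = pi - lam * pi" by (simp add: algebra_simps)
      ultimately show ?thesis using elim(1) \<open>\<bar>lam * Im (Ln (1 - z))\<bar> \<le> lam * pi\<close> by linarith
    qed
    then have Ln_w: "Ln (exp w) = w" by (intro Ln_exp) (auto simp: abs_less_iff)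
    have "exp w \<notin> \<real>\<^sub>\<le>\<^sub>0"
    proof
      assume "exp w \<in> \<real>\<^sub>\<le>\<^sub>0"
      then have "Re (exp w) < 0 \<and> Im (exp w) = 0"
        using exp_not_eq_zero[of w] by (auto simp: complex_nonpos_Reals_iff complex_eq_iff order_less_le)
      then have "Im (Ln (exp w)) = pi" using Im_Ln_eq_pi[of "exp w"] by simp
      then show False using Ln_w Im_w by simp
    qed
    then show ?case using Ln_w \<open>1 - G z = exp w\<close> by (simp add: w_def)
  qed
qed

section \<open>Coefficients of the logarithm and of the powers\<close>

lemma one_minus_G_notin_nonpos_Reals: "z \<in> cball 0 1 - {1} \<Longrightarrow> 1 - G z \<notin> \<real>\<^sub>\<le>\<^sub>0"
  using Re_G_less_1[of z] by (auto simp: complex_nonpos_Reals_iff)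

lemma G_has_fps_expansion: "G has_fps_expansion Abs_fps (\<lambda>n. complex_of_real (p n))"
  by (rule has_fps_expansion_of_sums[of 1]) (use G_series in auto)

text \<open>That \<open>1 - G\<close> avoids the cut is known in the two places where the transfer
  needs it: on the closed disc without 1, where its real part is positive, and near 1. It makes both
  Ln (1 - G) and 1 / (1 - G) analytic.\<close>

lemma transfer_little_o_G:
  assumes a: "0 \<le> a"
    and an: "\<And>z. z \<in> \<Delta> \<Longrightarrow> 1 - G z \<notin> \<real>\<^sub>\<le>\<^sub>0 \<Longrightarrow> f analytic_on {z}"
    and lim: "((\<lambda>z. f z * (1 - z) powr of_real a) \<longlongrightarrow> 0) (at 1 within \<Delta>)"
    and exp: "f has_fps_expansion F"
  shows "(\<lambda>n. F $ n * of_real (real n powr (1 - a))) \<longlonglongrightarrow> 0"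
proof -
  have "(\<lambda>n. (deriv ^^ n) f 0 / fact n * of_real (real n powr (1 - a))) \<longlonglongrightarrow> 0"
  proof (rule transfer_little_o[OF theta eps a _ _ lim])
    show "f analytic_on cball 0 1 - {1}"
      by (subst analytic_on_analytic_at) (auto intro!: an in_\<Delta> one_minus_G_notin_nonpos_Reals)
    show "\<forall>\<^sub>F z in at 1 within \<Delta>. f analytic_on {z}"
      using eventually_Ln_one_minus_G eventually_in_\<Delta> by eventually_elim (use an in auto)
  qed
  then show ?thesis by (simp add: fps_nth_fps_expansion[OF exp])
qed

text \<open>Subtracting lam (- Ln (1 - z)), with coefficients lam / n, leaves a function that tends
  to ln \<kappa>. This constant affects only the coefficient of index 0, but it has to go too,
  because the transfer with a = 0 wants an error that tends to 0; the error is then - Ln (q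
  z).\<close>

lemma log_coeff_tendsto:
  "(\<lambda>n. real n * (\<Sum>k\<le>n. (if k = 0 then 0 else 1 / real k) * (Abs_fps p ^ k) $ n)) \<longlonglongrightarrow> lam"
proof -
  let ?F = "\<lambda>n. \<Sum>k\<le>n. (if k = 0 then 0 else 1 / real k) * (Abs_fps p ^ k) $ n"
  define f where "f z = - Ln (1 - G z) - of_real lam * (- Ln (1 - z)) - of_real (ln \<kappa>)" for z
  define L where "L = Abs_fps (\<lambda>n. complex_of_real (if n = 0 then 0 else 1 / real n))"
  define F where "F = fps_compose L (Abs_fps (\<lambda>n. complex_of_real (p n))) - fps_const (of_real lam) * L - fps_const (of_real (ln \<kappa>))"
  have "(\<lambda>n. F $ n * of_real (real n powr (1 - 0))) \<longlonglongrightarrow> 0"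
  proof (rule transfer_little_o_G)
    fix z assume "z \<in> \<Delta>" "1 - G z \<notin> \<real>\<^sub>\<le>\<^sub>0"
    then show "f analytic_on {z}"
      unfolding f_def using one_minus_notin_nonpos_Reals[of z \<epsilon> \<theta>] theta
      by (intro analytic_intros G_analytic_at) auto
  next
    have "((\<lambda>z. - Ln (q z)) \<longlongrightarrow> - Ln 1) (at 1 within \<Delta>)" by (intro tendsto_intros q_tendsto) simp
    moreover have "\<forall>\<^sub>F z in at 1 within \<Delta>. - Ln (q z) = f z * (1 - z) powr of_real 0"
      using eventually_Ln_one_minus_G eventually_in_\<Delta> by eventually_elim (simp add: f_def)
    ultimately show "((\<lambda>z. f z * (1 - z) powr of_real 0) \<longlongrightarrow> 0) (at 1 within \<Delta>)"
      by (simp add: filterlim_cong)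
  next
    have "((\<lambda>z. - Ln (1 - z)) \<circ> G) has_fps_expansion fps_compose L (Abs_fps (\<lambda>n. complex_of_real (p n)))"
      unfolding L_def
      by (intro has_fps_expansion_compose Ln_one_minus_has_fps_expansion G_has_fps_expansion) (simp add: p_0)
    then show "f has_fps_expansion F"
      unfolding f_def [abs_def] F_def o_def L_def
      by (intro has_fps_expansion_diff has_fps_expansion_const has_fps_expansion_cmult_left Ln_one_minus_has_fps_expansion)
  qed simp
  moreover have "\<forall>\<^sub>F n in sequentially. F $ n * of_real (real n powr (1 - 0)) = of_real (real n * ?F n - lam)"
    using eventually_gt_at_top[of 0]
  proof eventually_elim
    case (elim n)
    have "F $ n = of_real (?F n - lam / real n)"
      unfolding F_def L_def fps_sub_nth of_real_fps_compose_nth using elim by simp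
    then have "F $ n * of_real (real n powr (1 - 0)) = of_real ((?F n - lam / real n) * real n)"
      using elim by (simp only: of_real_mult) simp
    moreover have "(y - lam / real n) * real n = real n * y - lam" for y
      using elim by (simp add: field_simps)
    ultimately show ?case by (simp only:)
  qed
  ultimately have "(\<lambda>n. complex_of_real (real n * ?F n - lam)) \<longlonglongrightarrow> of_real 0" by (simp add: filterlim_cong)
  then have "(\<lambda>n. real n * ?F n - lam) \<longlonglongrightarrow> 0" by (simp only: tendsto_of_real_iff)
  then show ?thesis by (subst (asm) LIM_zero_iff)
qed

text \<open>The main term \<kappa>^s (1 - z)^(- s lam) has binomial coefficients with known Gamma
  asymptotics. The error multiplied by (1 - z)^(s lam) is (\<kappa> G / q)^s - \<kappa>^s near 1,
  and this tends to 0.\<close>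

lemma power_coeff_tendsto:
  "(\<lambda>n. (\<Sum>k\<le>n. (if k = 0 then 0 else real ((k - 1) choose m)) * (Abs_fps p ^ k) $ n)
          * real n powr (1 - real (Suc m) * lam))
     \<longlonglongrightarrow> \<kappa> ^ Suc m / Gamma (real (Suc m) * lam)"
proof -
  define s where "s = Suc m"
  define a where "a = real s * lam"
  have a: "0 < a" using lambda by (simp add: a_def s_def)
  let ?C = "\<lambda>k. if k = 0 then 0 else real ((k - 1) choose m)"
  let ?N = "\<lambda>n. \<Sum>k\<le>n. ?C k * (Abs_fps p ^ k) $ n"
  define f where "f z = (G z / (1 - G z)) ^ s - of_real (\<kappa> ^ s) * (1 - z) powr (- of_real a)" for z
  define B where "B = Abs_fps (\<lambda>n. (- 1) ^ n * (- complex_of_real a gchoose n))"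
  define A where "A = Abs_fps (\<lambda>k. complex_of_real (?C k))"
  define F where "F = fps_compose A (Abs_fps (\<lambda>n. complex_of_real (p n))) - fps_const (of_real (\<kappa> ^ s)) * B"
  have "(\<lambda>n. F $ n * of_real (real n powr (1 - a))) \<longlonglongrightarrow> 0"
  proof (rule transfer_little_o_G)
    fix z assume z: "z \<in> \<Delta>" "1 - G z \<notin> \<real>\<^sub>\<le>\<^sub>0"
    then have "1 - G z \<noteq> 0" by auto
    then show "f analytic_on {z}"
      unfolding f_def using one_minus_notin_nonpos_Reals[of z \<epsilon> \<theta>] theta z
      by (intro analytic_intros G_analytic_at) auto
  next
    have "((\<lambda>z. (of_real \<kappa> * G z / q z) ^ s - of_real (\<kappa> ^ s)) \<longlongrightarrow> (of_real \<kappa> * 1 / 1) ^ s - of_real (\<kappa> ^ s)) (at 1 within \<Delta>)"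
      by (intro tendsto_intros q_tendsto G_tendsto) simp
    moreover have "\<forall>\<^sub>F z in at 1 within \<Delta>. (of_real \<kappa> * G z / q z) ^ s - of_real (\<kappa> ^ s) = f z * (1 - z) powr of_real a"
      using eventually_in_\<Delta>
    proof eventually_elim
      case (elim z)
      then have z: "1 - z \<noteq> 0" by simp
      have pw: "(1 - z) powr of_real a = ((1 - z) powr of_real lam) ^ s"
        using z by (simp add: powr_def a_def exp_of_nat_mult[symmetric] mult.assoc)
      have "of_real \<kappa> * G z / q z = G z / (1 - G z) * (1 - z) powr of_real lam"
        using z kappa_pos by (simp add: q_def)
      then have "(of_real \<kappa> * G z / q z) ^ s = (G z / (1 - G z)) ^ s * (1 - z) powr of_real a"
        unfolding pw by (simp only: power_mult_distrib)
      moreover have "(1 - z) powr (- of_real a) * (1 - z) powr of_real a = 1"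
        using z by (simp add: powr_minus)
      ultimately show ?case by (simp add: f_def left_diff_distrib mult.assoc)
    qed
    ultimately show "((\<lambda>z. f z * (1 - z) powr of_real a) \<longlongrightarrow> 0) (at 1 within \<Delta>)"
      by (simp add: filterlim_cong)
  next
    have "(\<lambda>z. (z / (1 - z)) ^ s) has_fps_expansion Abs_fps (\<lambda>k. if k = 0 then 0 else 1 :: complex) ^ s"
      by (intro has_fps_expansion_power geometric_has_fps_expansion)
    also have "Abs_fps (\<lambda>k. if k = 0 then 0 else 1 :: complex) ^ s = A"
      unfolding A_def s_def by (rule fps_ext) (auto simp: geometric_power_nth simp del: power_Suc)
    finally have "((\<lambda>z. (z / (1 - z)) ^ s) \<circ> G) has_fps_expansion fps_compose A (Abs_fps (\<lambda>n. complex_of_real (p n)))"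
      by (intro has_fps_expansion_compose G_has_fps_expansion) (simp_all add: p_0)
    then show "f has_fps_expansion F"
      unfolding f_def [abs_def] F_def o_def B_def
      by (intro has_fps_expansion_diff has_fps_expansion_cmult_left one_minus_powr_has_fps_expansion)
  qed (use a in simp)
  moreover have "(\<lambda>n. of_real (\<kappa> ^ s) * (B $ n * of_real (real n powr (1 - a)))) \<longlonglongrightarrow> of_real (\<kappa> ^ s) * inverse (Gamma (- (- complex_of_real a)))"
  proof (intro tendsto_mult tendsto_const)
    have "(\<lambda>n. (- complex_of_real a gchoose n) / ((- 1) ^ n / exp ((- complex_of_real a + 1) * of_real (ln (real n)))))
       \<longlonglongrightarrow> inverse (Gamma (- (- complex_of_real a)))" by (rule gbinomial_asymptotic)
    moreover have "\<forall>\<^sub>F n in sequentially. (- complex_of_real a gchoose n) / ((- 1) ^ n / exp ((- complex_of_real a + 1) * of_real (ln (real n))))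
       = B $ n * of_real (real n powr (1 - a))"
      using eventually_gt_at_top[of 0]
    proof eventually_elim
      case (elim n)
      have "exp ((- complex_of_real a + 1) * of_real (ln (real n))) = of_real (real n powr (1 - a))"
        using elim by (simp add: powr_def flip: exp_of_real)
      then show ?case by (cases "even n") (simp_all add: B_def)
    qed
    ultimately show "(\<lambda>n. B $ n * of_real (real n powr (1 - a))) \<longlonglongrightarrow> inverse (Gamma (- (- complex_of_real a)))"
      by (rule Lim_transform_eventually)
  qed
  ultimately have "(\<lambda>n. F $ n * of_real (real n powr (1 - a)) + of_real (\<kappa> ^ s) * (B $ n * of_real (real n powr (1 - a))))
     \<longlonglongrightarrow> 0 + of_real (\<kappa> ^ s) * inverse (Gamma (- (- complex_of_real a)))" by (rule tendsto_add)
  moreover have "F $ n * of_real (real n powr (1 - a)) + of_real (\<kappa> ^ s) * (B $ n * of_real (real n powr (1 - a)))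
      = complex_of_real (?N n * real n powr (1 - a))" for n
    unfolding F_def A_def fps_sub_nth of_real_fps_compose_nth by (simp add: algebra_simps)
  moreover have "0 + of_real (\<kappa> ^ s) * inverse (Gamma (- (- complex_of_real a))) = complex_of_real (\<kappa> ^ s / Gamma a)"
    by (simp add: Gamma_complex_of_real divide_inverse)
  ultimately have "(\<lambda>n. complex_of_real (?N n * real n powr (1 - a))) \<longlonglongrightarrow> complex_of_real (\<kappa> ^ s / Gamma a)"
    by (simp only:)
  then show ?thesis by (simp only: tendsto_of_real_iff a_def s_def)
qed

section \<open>Law and moments of the core size\<close>

definition D :: "nat \<Rightarrow> real" where
  "D n = (\<Sum>k\<le>n. (if k = 0 then 0 else 1 / real k) * (Abs_fps p ^ k) $ n)"

text \<open>Rescaling \<open>h\<close> to \<open>p\<close> multiplies the n-th coefficient of every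
  power by the same \<rho>^n, which cancels in this quotient. So \<open>core n\<close> gives the
  point probabilities of the core size.\<close>

definition core :: "nat \<Rightarrow> nat \<Rightarrow> real" where
  "core n k = (if k = 0 then 0 else 1 / real k) * (Abs_fps p ^ k) $ n / D n"

lemma eventually_D_pos: "\<forall>\<^sub>F n in sequentially. 0 < D n"
proof -
  have "\<forall>\<^sub>F n in sequentially. 0 < real n * D n"
    using log_coeff_tendsto unfolding D_def by (rule order_tendstoD) (rule lambda)
  then show ?thesis by eventually_elim (auto simp: zero_less_mult_iff)
qed

lemma sum_core: assumes "D n \<noteq> 0" shows "(\<Sum>k\<le>n. core n k) = 1"
  using assms unfolding core_def by (simp add: D_def flip: sum_divide_distrib)

text \<open>For s \<ge> 1 the numerator is asymptotic to (s-1)! \<kappa>^s n^(s lam - 1) / Gamma (s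
  lam) and the normalising coefficient to lam / n. Gamma (x + 1) = x Gamma (x) turns (s-1)! / (lam
  Gamma (s lam)) into the limit.\<close>

lemma factorial_moment_tendsto:
  "(\<lambda>n. (\<Sum>k\<le>n. core n k * (\<Prod>i<s. real k - real i)) / (\<kappa> * real n powr lam) ^ s)
     \<longlonglongrightarrow> Gamma (real s + 1) / Gamma (real s * lam + 1)"
proof (cases s)
  case 0
  have "\<forall>\<^sub>F n in sequentially. 1 = (\<Sum>k\<le>n. core n k)"
    using eventually_D_pos by eventually_elim (simp add: sum_core)
  then have "(\<lambda>n. \<Sum>k\<le>n. core n k) \<longlonglongrightarrow> 1" by (rule Lim_transform_eventually[OF tendsto_const])
  then show ?thesis by (simp add: 0)
next
  case (Suc m)
  define N where "N n = (\<Sum>k\<le>n. (if k = 0 then 0 else real ((k - 1) choose m)) * (Abs_fps p ^ k) $ n)" for n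
  have num: "(\<Sum>k\<le>n. core n k * (\<Prod>i<s. real k - real i)) = fact m * N n / D n" for n
  proof -
    have "core n k * (\<Prod>i<s. real k - real i)
        = fact m * ((if k = 0 then 0 else real ((k - 1) choose m)) * (Abs_fps p ^ k) $ n) / D n" for k
    proof (cases k)
      case (Suc j)
      then show ?thesis
        unfolding \<open>s = Suc m\<close> Suc falling_factorial_Suc core_def by (simp del: of_nat_Suc power_Suc)
    qed (simp add: core_def)
    then show ?thesis by (simp add: N_def sum_distrib_left sum_divide_distrib)
  qed
  have "(\<lambda>n. fact m * (N n * real n powr (1 - real s * lam)) / (real n * D n) / \<kappa> ^ s)
      \<longlonglongrightarrow> fact m * (\<kappa> ^ s / Gamma (real s * lam)) / lam / \<kappa> ^ s"
    unfolding N_def D_def Suc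
    by (intro tendsto_intros power_coeff_tendsto log_coeff_tendsto) (use lambda kappa_pos in auto)
  moreover have "\<forall>\<^sub>F n in sequentially. fact m * (N n * real n powr (1 - real s * lam)) / (real n * D n) / \<kappa> ^ s
     = (\<Sum>k\<le>n. core n k * (\<Prod>i<s. real k - real i)) / (\<kappa> * real n powr lam) ^ s"
    using eventually_gt_at_top[of 0]
  proof eventually_elim
    case (elim n)
    have "(real n powr lam) ^ s = real n powr (real s * lam)"
      using elim by (simp add: powr_powr mult.commute flip: powr_realpow)
    moreover have "real n powr (1 - real s * lam) = real n / real n powr (real s * lam)"
      using elim by (simp add: powr_diff)
    ultimately show ?case using elim by (simp add: num power_mult_distrib)
  qed
  ultimately have "(\<lambda>n. (\<Sum>k\<le>n. core n k * (\<Prod>i<s. real k - real i)) / (\<kappa> * real n powr lam) ^ s)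
     \<longlonglongrightarrow> fact m * (\<kappa> ^ s / Gamma (real s * lam)) / lam / \<kappa> ^ s" by (rule Lim_transform_eventually)
  also have "fact m * (\<kappa> ^ s / Gamma (real s * lam)) / lam / \<kappa> ^ s = Gamma (real s + 1) / Gamma (real s * lam + 1)"
  proof -
    have pos: "0 < real s * lam" using lambda by (simp add: Suc)
    have 1: "Gamma (real s * lam + 1) = real s * lam * Gamma (real s * lam)"
      using pos Gamma_plus1[of "real s * lam"] nonpos_Ints_nonpos[of "real s * lam"] by force
    have 2: "Gamma (real s + 1) = real s * fact m"
      using Gamma_fact[of s, where 'a = real] by (simp add: Suc add.commute)
    have "F * (K / g) / l / K = r * F / (r * l * g)" if "K > 0" "r > 0" for F K g l r :: real
      using that by simp
    then show ?thesis unfolding 1 2 using kappa_pos Suc by simp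
  qed
  finally show ?thesis .
qed

lemma scale_at_top: "filterlim (\<lambda>n. \<kappa> * real n powr lam) at_top sequentially"
  using kappa_pos lambda by real_asymp

lemma moment_tendsto:
  "(\<lambda>n. (\<Sum>k\<le>n. core n k * real k ^ s) / (\<kappa> * real n powr lam) ^ s)
     \<longlonglongrightarrow> Gamma (real s + 1) / Gamma (real s * lam + 1)"
  using moments_of_factorial_moments[OF scale_at_top factorial_moment_tendsto, of s 0] by simp

end

lemma critical_scheme_rescale:
  assumes h_nonneg: "\<And>n. 0 \<le> h n"
    and h_0: "h 0 = 0"
    and rho_pos: "0 < \<rho>"
    and H_series: "\<And>z. norm z < \<rho> \<Longrightarrow> (\<lambda>n. of_real (h n) * z ^ n) sums H z"
    and eps: "0 < \<epsilon>"
    and theta: "0 < \<theta>" "\<theta> < pi / 2"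
    and H_analytic: "H analytic_on delta_domain \<rho> \<epsilon> \<theta>"
    and lambda: "0 < lam" "lam < 1"
    and c_nonzero: "c \<noteq> 0"
    and H_expansion:
      "(\<lambda>z. H z - H (of_real \<rho>))
         \<sim>[at (of_real \<rho>) within delta_domain \<rho> \<epsilon> \<theta>]
       (\<lambda>z. of_real c * (1 - z / of_real \<rho>) powr of_real lam)"
    and critical: "H (of_real \<rho>) = 1"
  shows "critical_scheme (\<lambda>n. h n * \<rho> ^ n) (\<lambda>z. H (of_real \<rho> * z)) (\<epsilon> / \<rho>) \<theta> lam c"
proof
  let ?D = "delta_domain 1 (\<epsilon> / \<rho>) \<theta>"
  have scale: "of_real \<rho> * z \<in> delta_domain \<rho> \<epsilon> \<theta>" if "z \<in> ?D" for z
  proof -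
    have "\<rho> * norm z < \<rho> * (1 + \<epsilon> / \<rho>)"
      using that rho_pos by (intro mult_strict_left_mono) (auto simp: delta_domain_def)
    moreover have "Arg (of_real \<rho> * z - of_real \<rho>) = Arg (z - 1)"
      using Arg_times_of_real[OF rho_pos, of "z - 1"] by (simp add: algebra_simps)
    ultimately show ?thesis
      using that rho_pos by (simp add: delta_domain_def norm_mult algebra_simps)
  qed
  show "(\<lambda>n. of_real (h n * \<rho> ^ n) * z ^ n) sums H (of_real \<rho> * z)" if "norm z < 1" for z
    using H_series[of "of_real \<rho> * z"] that rho_pos by (simp add: norm_mult power_mult_distrib mult_ac)
  show "(\<lambda>z. H (of_real \<rho> * z)) analytic_on ?D"
    using analytic_on_compose_gen[of "\<lambda>z. of_real \<rho> * z" ?D H] scale H_analytic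
    by (auto simp: o_def intro!: analytic_intros)
  \<comment> \<open>The quotient from the definition of asymptotic equivalence, which sets 0 / 0 to
    1. Off the singularity its denominator is nonzero, so the plain quotient is recovered
    there.\<close>
  define r where "r z = (if H z - H (of_real \<rho>) = 0 \<and> of_real c * (1 - z / of_real \<rho>) powr of_real lam = 0
      then 1 else (H z - H (of_real \<rho>)) / (of_real c * (1 - z / of_real \<rho>) powr of_real lam))" for z
  have "(r \<longlongrightarrow> 1) (at (of_real \<rho>) within delta_domain \<rho> \<epsilon> \<theta>)"
    using asymp_equivD[OF H_expansion] unfolding r_def .
  moreover have "filterlim (\<lambda>z. of_real \<rho> * z) (at (of_real \<rho>) within delta_domain \<rho> \<epsilon> \<theta>) (at 1 within ?D)"
    unfolding filterlim_at using scale rho_pos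
    by (auto intro!: tendsto_eq_intros simp: eventually_at_filter)
  ultimately have "((\<lambda>z. r (of_real \<rho> * z)) \<longlongrightarrow> 1) (at 1 within ?D)" by (rule filterlim_compose)
  then have "((\<lambda>z. - of_real c * r (of_real \<rho> * z)) \<longlongrightarrow> - of_real c * 1) (at 1 within ?D)"
    by (intro tendsto_mult tendsto_const)
  moreover have "\<forall>\<^sub>F z in at 1 within ?D. - of_real c * r (of_real \<rho> * z)
      = (1 - H (of_real \<rho> * z)) / (1 - z) powr of_real lam"
    unfolding eventually_at_filter
  proof (rule always_eventually, intro allI impI)
    fix z :: complex assume "z \<noteq> 1" "z \<in> ?D"
    then have "(1 - z) powr of_real lam \<noteq> 0" by simp
    then show "- of_real c * r (of_real \<rho> * z) = (1 - H (of_real \<rho> * z)) / (1 - z) powr of_real lam"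
      using c_nonzero rho_pos by (simp add: r_def critical divide_simps)
  qed
  ultimately show "((\<lambda>z. (1 - H (of_real \<rho> * z)) / (1 - z) powr of_real lam) \<longlongrightarrow> - of_real c) (at 1 within ?D)"
    by (simp add: filterlim_cong)
qed (use assms in auto)

text \<open>The law is a quotient without meaning where [z^n] F(z,1) = 0, so \<open>M n\<close> and
  \<open>X n\<close> are constrained only for the other n. These turn out to include all large
  n.\<close>

theorem theorem7p1:
  fixes h :: "nat \<Rightarrow> real" and H :: "complex \<Rightarrow> complex"
    and \<rho> \<epsilon> \<theta> lam c \<kappa> :: real and \<mu> :: "nat \<Rightarrow> real"
    and M :: "nat \<Rightarrow> 'a measure" and X :: "nat \<Rightarrow> 'a \<Rightarrow> nat"
  assumes h_nonneg: "\<And>n. 0 \<le> h n"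
    and h_0: "h 0 = 0"
    and rho_pos: "0 < \<rho>"
    and radius: "conv_radius h = ereal \<rho>"
    and H_series: "\<And>z. norm z < \<rho> \<Longrightarrow> (\<lambda>n. of_real (h n) * z ^ n) sums H z"
    and eps: "0 < \<epsilon>"
    and theta: "0 < \<theta>" "\<theta> < pi / 2"
    and H_analytic: "H analytic_on delta_domain \<rho> \<epsilon> \<theta>"
    and lambda: "0 < lam" "lam < 1"
    and c_nonzero: "c \<noteq> 0"
    and H_expansion:
      "(\<lambda>z. H z - H (of_real \<rho>))
         \<sim>[at (of_real \<rho>) within delta_domain \<rho> \<epsilon> \<theta>]
       (\<lambda>z. of_real c * (1 - z / of_real \<rho>) powr of_real lam)"
    and critical: "H (of_real \<rho>) = 1"
    and prob: "\<And>n. fps_nth (cycle_gf_at_1 h) n \<noteq> 0 \<Longrightarrow> prob_space (M n)"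
    and X_measurable:
      "\<And>n. fps_nth (cycle_gf_at_1 h) n \<noteq> 0 \<Longrightarrow> X n \<in> measurable (M n) (count_space UNIV)"
    and X_law:
      "\<And>n k. fps_nth (cycle_gf_at_1 h) n \<noteq> 0 \<Longrightarrow>
         measure (M n) {\<omega> \<in> space (M n). X n \<omega> = k} = fps_nth (fps_nth (cycle_gf h) n) k / fps_nth (cycle_gf_at_1 h) n"
    and kappa: "\<kappa> = 1 / (- c)"
    and mu: "\<And>s. \<mu> s = Gamma (real s + 1) / Gamma (real s * lam + 1)"
  shows
    "(\<forall>s\<ge>1. (\<lambda>n. \<integral>\<omega>. (\<Prod>i<s. real (X n \<omega>) - real i) \<partial>M n)
         \<sim>[sequentially] (\<lambda>n. \<kappa> ^ s * real n powr (real s * lam) * \<mu> s)) \<and>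
     (\<exists>L. mittag_leffler_law lam L \<and>
        weak_conv_m (\<lambda>n. distr (M n) borel (\<lambda>\<omega>. real (X n \<omega>) / (\<kappa> * real n powr lam))) L \<and>
        (\<forall>s::nat. integrable L (\<lambda>x. x ^ s) \<and>
           (\<lambda>n. \<integral>\<omega>. (real (X n \<omega>) / (\<kappa> * real n powr lam)) ^ s \<partial>M n)
             \<longlonglongrightarrow> (\<integral>x. x ^ s \<partial>L)))"
proof -
  define p where "p n = h n * \<rho> ^ n" for n
  interpret S: critical_scheme p "\<lambda>z. H (of_real \<rho> * z)" "\<epsilon> / \<rho>" \<theta> lam c
    unfolding p_def
    by (rule critical_scheme_rescale[OF h_nonneg h_0 rho_pos H_series eps theta H_analytic lambda
          c_nonzero H_expansion critical])
  have kap: "S.\<kappa> = \<kappa>" by (simp add: S.\<kappa>_def kappa)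
  have kap_pos: "0 < \<kappa>" using S.kappa_pos by (simp add: kap)
  define b where "b n = \<kappa> * real n powr lam" for n
  let ?F = "\<lambda>n. cycle_gf_at_1 h $ n"
  let ?A = "\<lambda>n k. {\<omega> \<in> space (M n). X n \<omega> = k}"
  have coeff: "cycle_gf h $ n $ k * \<rho> ^ n = (if k = 0 then 0 else 1 / real k) * (Abs_fps p ^ k) $ n" for n k
    unfolding p_def [abs_def] fps_power_nth_scale cycle_gf_nth[where h = h, OF h_0] by simp
  have D: "S.D n = ?F n * \<rho> ^ n" for n
    unfolding S.D_def cycle_gf_at_1_nth[where h = h, OF h_0] sum_distrib_right coeff ..
  have F_nz: "\<forall>\<^sub>F n in sequentially. ?F n \<noteq> 0"
    using S.eventually_D_pos by eventually_elim (auto simp: D)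
  have law: "measure (M n) (?A n k) = S.core n k" if "?F n \<noteq> 0" for n k
    unfolding X_law[OF that] S.core_def D coeff[symmetric] using rho_pos by simp
  have hb: "has_bochner_integral (M n) (\<lambda>\<omega>. f (X n \<omega>)) (\<Sum>k\<le>n. S.core n k * f k)"
    if "?F n \<noteq> 0" for n and f :: "nat \<Rightarrow> real"
    unfolding law[OF that, symmetric]
    by (rule prob_space.has_bochner_integral_of_finite_range[OF prob[OF that] X_measurable[OF that]])
       (use S.sum_core[of n] rho_pos that in \<open>simp add: law[OF that] D\<close>)
  have falling: "(\<lambda>n. \<integral>\<omega>. (\<Prod>i<s. real (X n \<omega>) - real i) \<partial>M n)
         \<sim>[sequentially] (\<lambda>n. \<kappa> ^ s * real n powr (real s * lam) * \<mu> s)" for s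
  proof (rule asymp_equivI')
    have "\<mu> s > 0" unfolding mu using lambda by (intro divide_pos_pos Gamma_real_pos add_nonneg_pos) auto
    have "(\<lambda>n. (\<Sum>k\<le>n. S.core n k * (\<Prod>i<s. real k - real i)) / b n ^ s / \<mu> s) \<longlonglongrightarrow> \<mu> s / \<mu> s"
      unfolding b_def mu kap[symmetric]
      by (intro tendsto_divide S.factorial_moment_tendsto tendsto_const) (use \<open>\<mu> s > 0\<close> mu in auto)
    moreover have "\<forall>\<^sub>F n in sequentially. (\<Sum>k\<le>n. S.core n k * (\<Prod>i<s. real k - real i)) / b n ^ s / \<mu> s
       = (\<integral>\<omega>. (\<Prod>i<s. real (X n \<omega>) - real i) \<partial>M n) / (\<kappa> ^ s * real n powr (real s * lam) * \<mu> s)"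
      using F_nz eventually_gt_at_top[of 0]
    proof eventually_elim
      case (elim n)
      have "b n ^ s = \<kappa> ^ s * real n powr (real s * lam)"
        using elim by (simp add: b_def power_mult_distrib powr_powr mult.commute flip: powr_realpow)
      then show ?case
        using has_bochner_integral_integral_eq[OF hb[OF elim(1), of "\<lambda>k. \<Prod>i<s. real k - real i"]] by simp
    qed
    ultimately show "(\<lambda>n. (\<integral>\<omega>. (\<Prod>i<s. real (X n \<omega>) - real i) \<partial>M n) / (\<kappa> ^ s * real n powr (real s * lam) * \<mu> s)) \<longlonglongrightarrow> 1"
      using \<open>\<mu> s > 0\<close> by (simp add: filterlim_cong)
  qed
  obtain L where L: "mittag_leffler_law lam L" "real_distribution L"
    and hb_L: "\<And>s. has_bochner_integral L (\<lambda>x. x ^ s) (Gamma (real s + 1) / Gamma (real s * lam + 1))"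
    using mittag_leffler_law_exists[OF lambda] by blast
  have int_L: "integrable L (\<lambda>x. x ^ s)"
    and mom_L: "(\<integral>x. x ^ s \<partial>L) = Gamma (real s + 1) / Gamma (real s * lam + 1)" for s
    using hb_L[of s] by (simp_all add: has_bochner_integral_iff)
  have hbm: "has_bochner_integral (M n) (\<lambda>\<omega>. (real (X n \<omega>) / b n) ^ s) ((\<Sum>k\<le>n. S.core n k * real k ^ s) / b n ^ s)"
    if "?F n \<noteq> 0" for n s
    using hb[OF that, of "\<lambda>k. (real k / b n) ^ s"] by (simp add: power_divide sum_divide_distrib)
  have mom: "(\<lambda>n. \<integral>\<omega>. (real (X n \<omega>) / b n) ^ s \<partial>M n) \<longlonglongrightarrow> (\<integral>x. x ^ s \<partial>L)" for s
  proof (rule Lim_transform_eventually)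
    show "(\<lambda>n. (\<Sum>k\<le>n. S.core n k * real k ^ s) / b n ^ s) \<longlonglongrightarrow> (\<integral>x. x ^ s \<partial>L)"
      unfolding mom_L b_def kap[symmetric] by (rule S.moment_tendsto)
    show "\<forall>\<^sub>F n in sequentially. (\<Sum>k\<le>n. S.core n k * real k ^ s) / b n ^ s = (\<integral>\<omega>. (real (X n \<omega>) / b n) ^ s \<partial>M n)"
      using F_nz by eventually_elim (rule has_bochner_integral_integral_eq[OF hbm, symmetric])
  qed
  \<comment> \<open>Below \<open>n0\<close> the measure \<open>M n\<close> may be arbitrary and
    \<open>\<nu> n\<close> need not be a real distribution, so the method of moments is applied to
    the shifted sequence.\<close>
  obtain n0 where n0: "\<And>n. n0 \<le> n \<Longrightarrow> ?F n \<noteq> 0" using F_nz by (auto simp: eventually_sequentially)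
  define \<nu> where "\<nu> n = distr (M n) borel (\<lambda>\<omega>. real (X n \<omega>) / b n)" for n
  have meas: "(\<lambda>\<omega>. real (X n \<omega>) / b n) \<in> borel_measurable (M n)" if "?F n \<noteq> 0" for n
    using measurable_compose[OF X_measurable[OF that], of "\<lambda>k. real k / b n" borel] by simp
  have mom_\<nu>: "integrable (\<nu> n) (\<lambda>x. x ^ s)" "(\<integral>x. x ^ s \<partial>\<nu> n) = (\<integral>\<omega>. (real (X n \<omega>) / b n) ^ s \<partial>M n)"
    if "?F n \<noteq> 0" for n s
  proof -
    have "has_bochner_integral (\<nu> n) (\<lambda>x. x ^ s) (\<integral>\<omega>. (real (X n \<omega>) / b n) ^ s \<partial>M n)"
      unfolding \<nu>_def using hbm[OF that, of s] meas[OF that]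
      by (intro has_bochner_integral_distr) (auto simp: has_bochner_integral_iff)
    then show "integrable (\<nu> n) (\<lambda>x. x ^ s)" "(\<integral>x. x ^ s \<partial>\<nu> n) = (\<integral>\<omega>. (real (X n \<omega>) / b n) ^ s \<partial>M n)"
      by (simp_all add: has_bochner_integral_iff)
  qed
  have "weak_conv_m (\<lambda>n. \<nu> (n + n0)) L"
  proof (rule weak_conv_m_of_moments[OF _ L(2) _ int_L])
    show "real_distribution (\<nu> (n + n0))" for n
      unfolding \<nu>_def by (intro prob_space.real_distribution_distr prob meas n0) auto
    show "integrable (\<nu> (n + n0)) (\<lambda>x. x ^ k)" for n k by (rule mom_\<nu>(1)[OF n0]) simp
    show "(\<lambda>n. \<integral>x. x ^ k \<partial>\<nu> (n + n0)) \<longlonglongrightarrow> (\<integral>x. x ^ k \<partial>L)" for k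
      using LIMSEQ_ignore_initial_segment[OF mom[of k], of n0] by (simp add: mom_\<nu> n0)
    fix t :: real
    \<comment> \<open>The moment of order 2k of \<open>L\<close> is (2k)! / Gamma (2k lam + 1). Its
      factorial cancels that of the Taylor remainder, so \<open>growth\<close> holds for every lam >
      0.\<close>
    have "(\<lambda>k. t ^ (2 * k) / Gamma (real (2 * k) * lam + 1)) \<longlonglongrightarrow> 0"
      using power_over_Gamma_tendsto_0[OF lambda(1), of t]
      by (rule filterlim_compose[where g = "\<lambda>k. t ^ k / Gamma (real k * lam + 1)"])
         (intro filterlim_subseq strict_monoI, simp)
    moreover have "t ^ (2 * k) / fact (2 * k) * (\<integral>x. x ^ (2 * k) \<partial>L) = t ^ (2 * k) / Gamma (real (2 * k) * lam + 1)" for k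
      unfolding mom_L using Gamma_fact[of "2 * k", where 'a = real] by (simp add: add.commute)
    ultimately show "(\<lambda>k. t ^ (2 * k) / fact (2 * k) * (\<integral>x. x ^ (2 * k) \<partial>L)) \<longlonglongrightarrow> 0" by simp
  qed
  then have "weak_conv_m \<nu> L"
    unfolding weak_conv_m_def weak_conv_def by (blast intro: LIMSEQ_offset[of "\<lambda>n. cdf (\<nu> n) _" n0])
  then have weak: "weak_conv_m (\<lambda>n. distr (M n) borel (\<lambda>\<omega>. real (X n \<omega>) / (\<kappa> * real n powr lam))) L"
    unfolding \<nu>_def [abs_def] b_def .
  show ?thesis
    by (intro conjI exI[of _ L] allI impI falling L(1) weak int_L mom[unfolded b_def])
qed

end
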